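(* Let $\Omega\subset\mathbb{R}^2$ be a bounded domain with $C^3$ boundary. Then there exist $\overline{\delta}>0$ and a constant $C>0$ (independent of $\delta$ and $\mathbf{x}$) such that for every $0<\delta\le\overline{\delta}$ and every $\mathbf{x}\in\mathcal{I}\Omega_N$ the matrix $$\mathbf{A}(\mathbf{x}):=\frac{d}{m(\delta)}\int_{B_\delta(\mathbf{x})\cap\Omega}K(|\mathbf{y}-\mathbf{x}|)\,(\mathbf{y}-\mathbf{x})\otimes(\mathbf{y}-\mathbf{x})\,d\mathbf{y}$$ is invertible, so that the correction tensor $\mathbf{M}(\mathbf{x})=\mathbf{A}(\mathbf{x})^{-1}$ is a well-defined symmetric matrix. Moreover, writing matrices in the orthonormal basis $(\mathbf{p},\mathbf{n})=(\mathbf{p}(\overline{\mathbf{x}}),\mathbf{n}(\overline{\mathbf{x}}))$, with $$a_{pp}=\frac{d}{m(\delta)}\int_{B_\delta(\mathbf{x})\cap\Omega}K\,((\mathbf{y}-\mathbf{x})\cdot\mathbf{p})^2d\mathbf{y},\quad a_{nn}=\frac{d}{m(\delta)}\int_{B_\delta(\mathbf{x})\cap\Omega}K\,((\mathbf{y}-\mathbf{x})\cdot\mathbf{n})^2d\mathbf{y},$$ $$a_{pn}=\frac{d}{m(\delta)}\int_{B_\delta(\mathbf{x})\cap\Omega}K\,((\mathbf{y}-\mathbf{x})\cdot\mathbf{p})((\mathbf{y}-\mathbf{x})\cdot\mathbf{n})d\mathbf{y},$$ one has $|a_{pn}|\le C\delta^2$, and $$\mathbf{M}(\mathbf{x})=\begin{pmatrix}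 a_{pp}^{-1}+O(\delta^4) & O(\delta^2)\\ O(\delta^2) & a_{nn}^{-1}+O(\delta^4)\end{pmatrix},$$ where each $O(\delta^k)$ denotes a quantity bounded in absolute value by $C\delta^k$.
   Context: Dimension $d=2$. For a horizon $\delta>0$, $B_\delta(\mathbf{x})$ is the ball of radius $\delta$ centered at $\mathbf{x}$. The kernel is $K(r)=1/r$ for $0<r\le\delta$ and $K(r)=0$ for $r>\delta$; we write $K$ for $K(|\mathbf{y}-\mathbf{x}|)$. The weighted volume is $m(\delta)=\int_{B_\delta(\mathbf{x})}K(|\mathbf{y}-\mathbf{x}|)|\mathbf{y}-\mathbf{x}|^2d\mathbf{y}=2\pi\delta^3/3$. The boundary is split as $\partial\Omega=\partial\Omega_D\cup\partial\Omega_N$ with disjoint relative interiors (both are curves). $\mathcal{I}\Omega_N:=\{\mathbf{x}\in\Omega:\operatorname{dist}(\mathbf{x},\partial\Omega_N)<\delta\}$. It is assumed $\delta$ is small enough that each $\mathbf{x}\in\mathcal{I}\Omega_N$ has a unique orthogonal projection $\overline{\mathbf{x}}$ onto $\partial\Omega_N$, with $\overline{\mathbf{x}}-\mathbf{x}=s_x\mathbf{n}(\overline{\mathbf{x}})$, $0<s_x<\delta$; $\mathbf{n}(\overline{\mathbf{x}})$ is the outward unit normal and $\mathbf{p}(\overline{\mathbf{x}})$ the unit tangent at $\overline{\mathbf{x}}$. *)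

theory Defs
  imports "HOL-Analysis.Analysis"
begin

definition C3_on :: "real set \<Rightarrow> (real \<Rightarrow> real) \<Rightarrow> bool" where
  "C3_on S g \<longleftrightarrow> (\<exists>g1 g2 g3.
      (\<forall>t\<in>S. (g has_real_derivative g1 t) (at t)) \<and>
      (\<forall>t\<in>S. (g1 has_real_derivative g2 t) (at t)) \<and>
      (\<forall>t\<in>S. (g2 has_real_derivative g3 t) (at t)) \<and>
      continuous_on S g3)"

definition C3_chart :: "(real^2) set \<Rightarrow> real^2 \<Rightarrow> real \<Rightarrow> real^2 \<Rightarrow> real^2 \<Rightarrow> (real \<Rightarrow> real) \<Rightarrow> bool" where
  "C3_chart \<Omega> z r e1 e2 g \<longleftrightarrow>
     r > 0 \<and> norm e1 = 1 \<and> norm e2 = 1 \<and> e1 \<bullet> e2 = 0 \<and> C3_on {-r<..<r} g \<and>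
     (\<forall>y\<in>ball z r. y \<in> \<Omega> \<longleftrightarrow> (y - z) \<bullet> e2 < g ((y - z) \<bullet> e1))"

definition C3_boundary :: "(real^2) set \<Rightarrow> bool" where
  "C3_boundary \<Omega> \<longleftrightarrow> (\<forall>z\<in>frontier \<Omega>. \<exists>r e1 e2 g. C3_chart \<Omega> z r e1 e2 g)"

definition bounded_domain :: "(real^2) set \<Rightarrow> bool" where
  "bounded_domain \<Omega> \<longleftrightarrow> open \<Omega> \<and> connected \<Omega> \<and> bounded \<Omega> \<and> \<Omega> \<noteq> {}"

text \<open>n is the outward unit normal of Omega at the boundary point z
  (normal to the graph of the local chart, pointing away from Omega).\<close>
definition outward_normal :: "(real^2) set \<Rightarrow> real^2 \<Rightarrow> real^2 \<Rightarrow> bool" where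
  "outward_normal \<Omega> z n \<longleftrightarrow> (\<exists>r e1 e2 g d. C3_chart \<Omega> z r e1 e2 g \<and>
      (g has_real_derivative d) (at 0) \<and>
      n = (1 / sqrt (1 + d\<^sup>2)) *\<^sub>R (e2 - d *\<^sub>R e1))"

definition tangent_of :: "real^2 \<Rightarrow> real^2" where
  "tangent_of n = vector [- (n$2), n$1]"

definition kernel :: "real \<Rightarrow> real \<Rightarrow> real" where
  "kernel \<delta> r = (if 0 < r \<and> r \<le> \<delta> then 1 / r else 0)"

definition mvol :: "real \<Rightarrow> real" where
  "mvol \<delta> = 2 * pi * \<delta> ^ 3 / 3"

definition I_Omega_N :: "(real^2) set \<Rightarrow> (real^2) set \<Rightarrow> real \<Rightarrow> (real^2) set" where
  "I_Omega_N \<Omega> \<Gamma>N \<delta> = {x\<in>\<Omega>. infdist x \<Gamma>N < \<delta>}"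

definition Amat :: "(real^2) set \<Rightarrow> real \<Rightarrow> real^2 \<Rightarrow> real^2^2" where
  "Amat \<Omega> \<delta> x = (\<chi> i j. (2 / mvol \<delta>) *
      integral (ball x \<delta> \<inter> \<Omega>) (\<lambda>y. kernel \<delta> (norm (y - x)) * ((y - x) $ i) * ((y - x) $ j)))"

definition acoef :: "(real^2) set \<Rightarrow> real \<Rightarrow> real^2 \<Rightarrow> real^2 \<Rightarrow> real^2 \<Rightarrow> real" where
  "acoef \<Omega> \<delta> x u v = (2 / mvol \<delta>) *
      integral (ball x \<delta> \<inter> \<Omega>) (\<lambda>y. kernel \<delta> (norm (y - x)) * ((y - x) \<bullet> u) * ((y - x) \<bullet> v))"

end

theory Submission
  imports Defs
begin

text \<open>
  With \<open>t\<close>, \<open>u\<close> the coordinates in the frame \<open>(p, n)\<close> at the projection of \<open>x\<close>, the boundary is a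
  parabola \<open>u = \<kappa> t\<^sup>2\<close> up to third order, uniformly in the boundary point by compactness. The part of
  the ball below the parabola is symmetric under \<open>t \<mapsto> -t\<close> while the integrand of \<open>a\<^sub>p\<^sub>n\<close> is odd, so
  \<open>a\<^sub>p\<^sub>n\<close> only sees the strip between parabola and boundary, of area \<open>O(\<delta>\<^sup>4)\<close>; since the integrand
  is \<open>O(\<delta>)\<close>, dividing by \<open>m(\<delta>)\<close> leaves \<open>O(\<delta>\<^sup>2)\<close>. The diagonal entries are bounded below because the
  domain contains a ball of radius \<open>\<delta>/8\<close> away from both axes. The expansion of the inverse is then
  read off Cramer's rule.
\<close>

section \<open>Orthonormal frames and matrices in the plane\<close>

definition orthonormal_frame :: "'a::real_inner \<Rightarrow> 'a \<Rightarrow> bool" where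
  "orthonormal_frame p n \<longleftrightarrow> norm p = 1 \<and> norm n = 1 \<and> p \<bullet> n = 0"

lemma orthonormal_frame_swap: "orthonormal_frame p n \<Longrightarrow> orthonormal_frame n p"
  by (simp add: orthonormal_frame_def inner_commute)

lemma orthonormal_frame_inner:
  assumes "orthonormal_frame p n"
  shows "p \<bullet> p = 1" "n \<bullet> n = 1" "p \<bullet> n = 0" "n \<bullet> p = 0"
  using assms by (simp_all add: orthonormal_frame_def norm_eq_1 inner_commute)

lemma orthonormal_frame_tangent_of: "norm n = 1 \<Longrightarrow> orthonormal_frame (tangent_of n) n"
  by (simp add: orthonormal_frame_def norm_eq_1 inner_vec_def sum_2 tangent_of_def)

lemma orthonormal_frame_expand:
  fixes p n h :: "real^2"
  assumes "orthonormal_frame p n"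
  shows "(h \<bullet> p) *\<^sub>R p + (h \<bullet> n) *\<^sub>R n = h"
proof -
  have "p \<noteq> n"
    using orthonormal_frame_inner[OF assms] by auto
  have "pairwise orthogonal {p, n}"
    using orthonormal_frame_inner[OF assms] by (auto simp: pairwise_def orthogonal_def)
  moreover have "0 \<notin> {p, n}"
    using assms by (auto simp: orthonormal_frame_def)
  ultimately have "independent {p, n}"
    by (rule pairwise_orthogonal_independent)
  then have "h \<in> span {p, n}"
    using card_ge_dim_independent[of "{p, n}" UNIV] \<open>p \<noteq> n\<close> by auto
  then have "(\<Sum>i\<in>{p, n}. (h \<bullet> i) *\<^sub>R i) = h"
    using \<open>pairwise orthogonal {p, n}\<close> assms
    by (intro orthonormal_basis_expand) (auto simp: orthonormal_frame_def)
  then show ?thesis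
    using \<open>p \<noteq> n\<close> by simp
qed

lemma inner_orthonormal_frame:
  fixes a b :: "real^2"
  assumes "orthonormal_frame p n"
  shows "a \<bullet> b = (a \<bullet> p) * (b \<bullet> p) + (a \<bullet> n) * (b \<bullet> n)"
proof -
  have "a \<bullet> b = ((a \<bullet> p) *\<^sub>R p + (a \<bullet> n) *\<^sub>R n) \<bullet> b"
    by (simp only: orthonormal_frame_expand[OF assms])
  then show ?thesis
    by (simp add: inner_add_left inner_commute[of p b] inner_commute[of n b])
qed

lemma norm_orthonormal_frame:
  fixes h :: "real^2"
  assumes "orthonormal_frame p n"
  shows "(norm h)\<^sup>2 = (h \<bullet> p)\<^sup>2 + (h \<bullet> n)\<^sup>2"
  using inner_orthonormal_frame[OF assms, of h h]
  unfolding power2_norm_eq_inner by (simp add: power2_eq_square)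

lemma abs_inner_le_norm: "norm u = 1 \<Longrightarrow> \<bar>h \<bullet> u\<bar> \<le> norm h"
  using Cauchy_Schwarz_ineq2[of h u] by simp

lemma matrix_vector_mul_matrix_inv:
  fixes A :: "'a::field^'n^'n"
  assumes "invertible A"
  shows "A *v (matrix_inv A *v x) = x"
proof -
  have "A ** matrix_inv A = mat 1 \<and> matrix_inv A ** A = mat 1"
    using assms unfolding invertible_def matrix_inv_def by (rule someI_ex)
  then show ?thesis
    by (simp add: matrix_vector_mul_assoc)
qed

lemma inner_matrix_vector_commute:
  fixes A :: "real^'n^'n"
  assumes "transpose A = A"
  shows "x \<bullet> (A *v y) = y \<bullet> (A *v x)"
  by (metis assms dot_lmul_matrix inner_commute transpose_matrix_vector)

lemma transpose_eq_selfI: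
  fixes A :: "real^'n^'n"
  assumes "\<And>x y. x \<bullet> (A *v y) = y \<bullet> (A *v x)"
  shows "transpose A = A"
proof -
  have "(transpose A *v y) \<bullet> x = (A *v y) \<bullet> x" for x y
    using assms[of x y] by (simp add: dot_lmul_matrix inner_commute[of "A *v y"])
  then show ?thesis
    by (metis matrix_eq vector_eq_rdot)
qed

lemma transpose_matrix_inv:
  fixes A :: "real^'n^'n"
  assumes "transpose A = A" "invertible A"
  shows "transpose (matrix_inv A) = matrix_inv A"
proof (rule transpose_eq_selfI)
  fix x y
  have "x \<bullet> (matrix_inv A *v y) = (A *v (matrix_inv A *v x)) \<bullet> (matrix_inv A *v y)"
    by (simp add: matrix_vector_mul_matrix_inv[OF assms(2)])
  also have "\<dots> = (A *v (matrix_inv A *v y)) \<bullet> (matrix_inv A *v x)"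
    using inner_matrix_vector_commute[OF assms(1)] by (simp only: inner_commute)
  also have "\<dots> = y \<bullet> (matrix_inv A *v x)"
    by (simp add: matrix_vector_mul_matrix_inv[OF assms(2)])
  finally show "x \<bullet> (matrix_inv A *v y) = y \<bullet> (matrix_inv A *v x)" .
qed

lemma abs_det_orthonormal_frame:
  fixes p n :: "real^2"
  assumes "orthonormal_frame p n"
  shows "\<bar>p$1 * n$2 - p$2 * n$1\<bar> = 1"
proof -
  have "(p \<bullet> n)\<^sup>2 + (p$1 * n$2 - p$2 * n$1)\<^sup>2 = (p \<bullet> p) * (n \<bullet> n)"
    by (simp add: inner_vec_def sum_2 power2_eq_square algebra_simps)
  then have "(p$1 * n$2 - p$2 * n$1)\<^sup>2 = 1"
    using orthonormal_frame_inner[OF assms] by simp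
  then show ?thesis
    by (simp add: abs_square_eq_1)
qed

lemma det_orthonormal_frame:
  fixes A :: "real^2^2"
  assumes "orthonormal_frame p n"
  shows "det A = (p \<bullet> (A *v p)) * (n \<bullet> (A *v n)) - (p \<bullet> (A *v n)) * (n \<bullet> (A *v p))"
proof -
  have "(p \<bullet> (A *v p)) * (n \<bullet> (A *v n)) - (p \<bullet> (A *v n)) * (n \<bullet> (A *v p))
      = det A * (p$1 * n$2 - p$2 * n$1)\<^sup>2"
    by (simp add: det_2 inner_vec_def matrix_vector_mult_def sum_2) algebra
  also have "(p$1 * n$2 - p$2 * n$1)\<^sup>2 = 1"
    using abs_det_orthonormal_frame[OF assms] by (simp add: abs_square_eq_1)
  finally show ?thesis
    by simp
qed

lemma cramer_orthonormal_frame: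
  fixes A :: "real^2^2"
  assumes "orthonormal_frame p n"
  shows "det A * (p \<bullet> x) = (n \<bullet> (A *v n)) * (p \<bullet> (A *v x)) - (p \<bullet> (A *v n)) * (n \<bullet> (A *v x))"
proof -
  have "A *v x = A *v ((p \<bullet> x) *\<^sub>R p + (n \<bullet> x) *\<^sub>R n)"
    using orthonormal_frame_expand[OF assms, of x] by (simp add: inner_commute)
  then have "A *v x = (p \<bullet> x) *\<^sub>R (A *v p) + (n \<bullet> x) *\<^sub>R (A *v n)"
    by (simp add: matrix_vector_right_distrib matrix_vector_mult_scaleR)
  then show ?thesis
    by (simp add: det_orthonormal_frame[OF assms] inner_add_right algebra_simps)
qed

lemma matrix_inv_frame_entries:
  fixes A :: "real^2^2"
  assumes "orthonormal_frame p n" "invertible A"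
  shows "p \<bullet> (matrix_inv A *v p) = (n \<bullet> (A *v n)) / det A"
    and "p \<bullet> (matrix_inv A *v n) = - (p \<bullet> (A *v n)) / det A"
proof -
  have "det A * (p \<bullet> (matrix_inv A *v b))
      = (n \<bullet> (A *v n)) * (p \<bullet> b) - (p \<bullet> (A *v n)) * (n \<bullet> b)" for b
    using cramer_orthonormal_frame[OF assms(1), of A "matrix_inv A *v b"]
    by (simp add: matrix_vector_mul_matrix_inv[OF assms(2)])
  from this[of p] this[of n]
  show "p \<bullet> (matrix_inv A *v p) = (n \<bullet> (A *v n)) / det A"
    and "p \<bullet> (matrix_inv A *v n) = - (p \<bullet> (A *v n)) / det A"
    using orthonormal_frame_inner[OF assms(1)] assms(2)
    by (simp_all add: invertible_det_nz field_simps)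
qed

lemma matrix_inv_diagonal_entry_diff:
  fixes A :: "real^2^2"
  assumes "orthonormal_frame p n" "invertible A" "p \<bullet> (A *v p) \<noteq> 0"
  shows "p \<bullet> (matrix_inv A *v p) - 1 / (p \<bullet> (A *v p))
    = (p \<bullet> (A *v n)) * (n \<bullet> (A *v p)) / ((p \<bullet> (A *v p)) * det A)"
proof -
  have "det A \<noteq> 0"
    using assms(2) by (simp add: invertible_det_nz)
  then have "(n \<bullet> (A *v n)) / det A - 1 / (p \<bullet> (A *v p))
      = ((p \<bullet> (A *v p)) * (n \<bullet> (A *v n)) - det A) / ((p \<bullet> (A *v p)) * det A)"
    using assms(3) by (simp add: field_simps)
  then show ?thesis
    by (simp add: matrix_inv_frame_entries(1)[OF assms(1,2)] det_orthonormal_frame[OF assms(1)])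
qed

lemma det_nearly_diagonal_ge:
  fixes A :: "real^2^2"
  assumes "orthonormal_frame p n" "transpose A = A"
    and "0 \<le> c" "c \<le> p \<bullet> (A *v p)" "c \<le> n \<bullet> (A *v n)"
    and "2 * (p \<bullet> (A *v n))\<^sup>2 \<le> c\<^sup>2"
  shows "c\<^sup>2 / 2 \<le> det A"
proof -
  have "c * c \<le> (p \<bullet> (A *v p)) * (n \<bullet> (A *v n))"
    using assms(3-5) by (intro mult_mono) auto
  then show ?thesis
    using assms(6) inner_matrix_vector_commute[OF assms(2), of n p]
    by (simp add: det_orthonormal_frame[OF assms(1)] power2_eq_square)
qed

lemma matrix_inv_nearly_diagonal:
  fixes A :: "real^2^2"
  assumes frame: "orthonormal_frame p n" and sym: "transpose A = A"
    and diagonal: "0 < c" "c \<le> p \<bullet> (A *v p)" "c \<le> n \<bullet> (A *v n)"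
    and mixed: "\<bar>p \<bullet> (A *v n)\<bar> \<le> \<epsilon>" "2 * \<epsilon>\<^sup>2 \<le> c\<^sup>2"
  shows "invertible A"
    and "\<bar>p \<bullet> (matrix_inv A *v p) - 1 / (p \<bullet> (A *v p))\<bar> \<le> 2 / c ^ 3 * \<epsilon>\<^sup>2"
    and "\<bar>p \<bullet> (matrix_inv A *v n)\<bar> \<le> 2 / c\<^sup>2 * \<epsilon>"
proof -
  have mixed_square: "(p \<bullet> (A *v n))\<^sup>2 \<le> \<epsilon>\<^sup>2"
    using mixed(1) by (intro abs_le_square_iff[THEN iffD1]) linarith
  have det_ge: "c\<^sup>2 / 2 \<le> det A"
    using diagonal mixed(2) mixed_square by (intro det_nearly_diagonal_ge[OF frame sym]) auto
  moreover have "0 < c\<^sup>2 / 2"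
    using diagonal(1) by simp
  ultimately have "0 < det A"
    by linarith
  then show invertible: "invertible A"
    by (simp add: invertible_det_nz)
  have "\<bar>p \<bullet> (matrix_inv A *v n)\<bar> = \<bar>p \<bullet> (A *v n)\<bar> / det A"
    using \<open>0 < det A\<close> by (simp add: matrix_inv_frame_entries(2)[OF frame invertible])
  also have "\<dots> \<le> \<epsilon> / (c\<^sup>2 / 2)"
    using diagonal(1) mixed(1) det_ge by (intro frac_le) auto
  finally show "\<bar>p \<bullet> (matrix_inv A *v n)\<bar> \<le> 2 / c\<^sup>2 * \<epsilon>"
    by (simp add: mult.commute)
  have "p \<bullet> (matrix_inv A *v p) - 1 / (p \<bullet> (A *v p)) = (p \<bullet> (A *v n))\<^sup>2 / ((p \<bullet> (A *v p)) * det A)"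
    using matrix_inv_diagonal_entry_diff[OF frame invertible] diagonal(1,2)
    by (simp add: power2_eq_square inner_matrix_vector_commute[OF sym, of n p])
  then have "\<bar>p \<bullet> (matrix_inv A *v p) - 1 / (p \<bullet> (A *v p))\<bar>
      = (p \<bullet> (A *v n))\<^sup>2 / ((p \<bullet> (A *v p)) * det A)"
    using \<open>0 < det A\<close> diagonal(1,2) by simp
  also have "\<dots> \<le> \<epsilon>\<^sup>2 / (c * (c\<^sup>2 / 2))"
    using diagonal(1,2) det_ge mixed_square by (intro frac_le mult_mono) auto
  also have "\<dots> = 2 / c ^ 3 * \<epsilon>\<^sup>2"
    by (simp add: power2_eq_square power3_eq_cube mult_ac)
  finally show "\<bar>p \<bullet> (matrix_inv A *v p) - 1 / (p \<bullet> (A *v p))\<bar> \<le> 2 / c ^ 3 * \<epsilon>\<^sup>2" .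
qed

section \<open>Isometries and strips\<close>

lemma integral_const_lmeasurable:
  fixes c :: real
  assumes "S \<in> lmeasurable"
  shows "integral S (\<lambda>_. c) = c * measure lebesgue S"
  using integral_mult_right[of S c "\<lambda>_. 1"] by (simp add: lmeasure_integral[OF assms])

lemma abs_integral_diff_le:
  fixes f :: "'a::euclidean_space \<Rightarrow> real"
  assumes integrable: "f integrable_on S" "f integrable_on T"
    and cover: "W \<in> lmeasurable" "sym_diff S T \<subseteq> W"
    and bound: "\<And>y. y \<in> W \<Longrightarrow> \<bar>f y\<bar> \<le> B"
  shows "\<bar>integral S f - integral T f\<bar> \<le> B * measure lebesgue W"
proof -
  define restr where "restr = (\<lambda>A y. if y \<in> A then f y else 0)"
  have "integral S f - integral T f = integral UNIV (\<lambda>y. restr S y - restr T y)"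
    using integrable
    by (simp add: restr_def integral_diff integrable_restrict_UNIV integral_restrict_UNIV)
  also have "norm \<dots> \<le> integral UNIV (\<lambda>y. if y \<in> W then B else 0)"
  proof (rule integral_norm_bound_integral)
    show "(\<lambda>y. restr S y - restr T y) integrable_on UNIV"
      using integrable by (simp add: restr_def integrable_diff integrable_restrict_UNIV)
    show "(\<lambda>y. if y \<in> W then B else 0) integrable_on UNIV"
      using cover(1) by (simp add: integrable_restrict_UNIV integrable_on_const)
    show "norm (restr S y - restr T y) \<le> (if y \<in> W then B else 0)" for y
      using cover(2) bound[of y] by (auto simp: restr_def)
  qed
  also have "\<dots> = B * measure lebesgue W"
    by (simp add: integral_restrict_UNIV integral_const_lmeasurable[OF cover(1)])
  finally show ?thesis
    by simp
qed

lemma integral_isometry_image: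
  fixes f :: "real^'n::{finite,wellorder} \<Rightarrow> real" and L :: "real^'n::_ \<Rightarrow> real^'n::_"
  assumes orthogonal: "orthogonal_transformation L" and affine: "T = (\<lambda>y. a + L (y - b))"
    and S_sets: "S \<in> sets lebesgue" and f_integrable: "f absolutely_integrable_on (T ` S)"
  shows "integral (T ` S) f = integral S (\<lambda>y. f (T y))"
proof -
  define F :: "real^'n::_ \<Rightarrow> real^1" where "F = (\<lambda>y. vec (f y))"
  have "linear L"
    using orthogonal by (rule orthogonal_transformation_linear)
  then have T_eq: "T = (\<lambda>y. L y + (a - L b))"
    by (simp add: affine linear_diff algebra_simps)
  have "(T has_derivative L) (at y within S)" for y
    unfolding T_eq by (intro has_derivative_add_const linear_imp_has_derivative \<open>linear L\<close>)
  moreover have "inj_on T S"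
    by (rule inj_onI) (simp add: affine inj_eq[OF orthogonal_transformation_inj[OF orthogonal]])
  moreover have "F absolutely_integrable_on (T ` S)"
    using f_integrable by (simp add: absolutely_integrable_on_1_iff F_def)
  ultimately have "integral (T ` S) F = integral S (\<lambda>y. \<bar>det (matrix L)\<bar> *\<^sub>R F (T y))"
    using S_sets by (intro integral_change_of_variables[where g' = "\<lambda>_. L"]) auto
  then have "integral (T ` S) F = integral S (\<lambda>y. F (T y))"
    using orthogonal by simp
  then show ?thesis
    unfolding integral_on_1_eq by (simp add: F_def vec_eq_iff)
qed

lemma integral_odd_eq_0:
  fixes f :: "real^'n::{finite,wellorder} \<Rightarrow> real"
  assumes "orthogonal_transformation L" "T = (\<lambda>y. a + L (y - b))" "T ` S = S"
    and "S \<in> sets lebesgue" "f absolutely_integrable_on S" "\<And>y. f (T y) = - f y"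
  shows "integral S f = 0"
  using integral_isometry_image[of L T a b S f] assms by simp

definition reflection :: "'a::real_inner \<Rightarrow> 'a \<Rightarrow> 'a" where
  "reflection p h = h - (2 * (h \<bullet> p)) *\<^sub>R p"

lemma inner_reflection:
  assumes "norm p = 1"
  shows "reflection p h \<bullet> reflection p k = h \<bullet> k"
  using assms
  by (simp add: reflection_def inner_diff inner_commute[of p k] norm_eq_1 algebra_simps)

lemma norm_reflection: "norm p = 1 \<Longrightarrow> norm (reflection p h) = norm h"
  by (simp add: norm_eq_sqrt_inner[of "reflection p h"] norm_eq_sqrt_inner[of h] inner_reflection)

lemma reflection_reflection: "norm p = 1 \<Longrightarrow> reflection p (reflection p h) = h"
  by (simp add: reflection_def inner_diff norm_eq_1 algebra_simps)

lemma orthogonal_transformation_reflection: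
  assumes "norm p = 1"
  shows "orthogonal_transformation (reflection p)"
  unfolding orthogonal_transformation_def
proof
  show "linear (reflection p)"
    by (rule linearI) (simp_all add: reflection_def inner_add_left algebra_simps)
qed (simp add: inner_reflection[OF assms])

lemma reflection_inner_frame:
  assumes "orthonormal_frame p n"
  shows "reflection p h \<bullet> p = - (h \<bullet> p)" "reflection p h \<bullet> n = h \<bullet> n"
  using orthonormal_frame_inner[OF assms] by (simp_all add: reflection_def inner_diff)

definition graph_strip ::
    "real^2 \<Rightarrow> real^2 \<Rightarrow> real^2 \<Rightarrow> (real \<Rightarrow> real) \<Rightarrow> real \<Rightarrow> real \<Rightarrow> (real^2) set" where
  "graph_strip z p n \<phi> \<delta> \<epsilon> = {y. \<bar>(y - z) \<bullet> p\<bar> \<le> \<delta> \<and> \<bar>(y - z) \<bullet> n - \<phi> ((y - z) \<bullet> p)\<bar> \<le> \<epsilon>}"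

lemma graph_strip_eq_image:
  fixes z :: "real^2"
  assumes frame: "orthonormal_frame p n"
  shows "graph_strip z p n \<phi> \<delta> \<epsilon>
    = (\<lambda>a::real^2. z + a$1 *\<^sub>R p + (\<phi> (a$1) + a$2) *\<^sub>R n) `
      cbox (vector [-\<delta>, -\<epsilon>]) (vector [\<delta>, \<epsilon>])"
    (is "_ = ?f ` ?R")
proof (intro equalityI subsetI)
  fix y assume y_mem: "y \<in> graph_strip z p n \<phi> \<delta> \<epsilon>"
  define a :: "real^2" where "a = vector [(y - z) \<bullet> p, (y - z) \<bullet> n - \<phi> ((y - z) \<bullet> p)]"
  have "y = ?f a"
    using orthonormal_frame_expand[OF frame, of "y - z"] by (simp add: a_def algebra_simps)
  moreover have "a \<in> ?R"
    using y_mem by (auto simp: graph_strip_def a_def mem_box_cart forall_2 abs_le_iff)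
  ultimately show "y \<in> ?f ` ?R"
    by blast
next
  fix y assume "y \<in> ?f ` ?R"
  then show "y \<in> graph_strip z p n \<phi> \<delta> \<epsilon>"
    using orthonormal_frame_inner[OF frame]
    by (auto simp: graph_strip_def mem_box_cart forall_2 inner_add_left abs_le_iff)
qed

lemma graph_strip_measure:
  assumes frame: "orthonormal_frame p n" and \<phi>_derivative: "\<And>t. (\<phi> has_real_derivative \<phi>' t) (at t)"
    and "0 \<le> \<delta>" "0 \<le> \<epsilon>"
  shows "graph_strip z p n \<phi> \<delta> \<epsilon> \<in> lmeasurable"
    and "measure lebesgue (graph_strip z p n \<phi> \<delta> \<epsilon>) \<le> 4 * \<delta> * \<epsilon>"
proof -
  define f :: "real^2 \<Rightarrow> real^2" where "f = (\<lambda>a. z + a$1 *\<^sub>R p + (\<phi> (a$1) + a$2) *\<^sub>R n)"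
  define f' :: "real^2 \<Rightarrow> real^2 \<Rightarrow> real^2" where
    "f' = (\<lambda>a h. h$1 *\<^sub>R p + (\<phi>' (a$1) * h$1 + h$2) *\<^sub>R n)"
  define R :: "(real^2) set" where "R = cbox (vector [-\<delta>, -\<epsilon>]) (vector [\<delta>, \<epsilon>])"
  have nth_derivative: "((\<lambda>a::real^2. a $ i) has_derivative (\<lambda>h. h $ i)) (at a within R)" for a i
    by (rule bounded_linear_imp_has_derivative[OF bounded_linear_vec_nth])
  have derivative: "(f has_derivative f' a) (at a within R)" for a
    unfolding f_def f'_def
    by (auto intro!: derivative_eq_intros nth_derivative DERIV_compose_FDERIV[OF \<phi>_derivative])
  have abs_det: "\<bar>det (matrix (f' a))\<bar> = 1" for a
    using abs_det_orthonormal_frame[OF frame]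
    by (simp add: det_2 matrix_def f'_def axis_def algebra_simps)
  have R_meas: "R \<in> lmeasurable" "R \<in> sets lebesgue"
    by (simp_all add: R_def)
  have integrable: "(\<lambda>a. \<bar>det (matrix (f' a))\<bar>) integrable_on R"
    using R_meas by (simp add: abs_det integrable_on_const)
  have strip_eq: "graph_strip z p n \<phi> \<delta> \<epsilon> = f ` R"
    unfolding f_def R_def by (rule graph_strip_eq_image[OF frame])
  show "graph_strip z p n \<phi> \<delta> \<epsilon> \<in> lmeasurable"
    unfolding strip_eq by (rule measurable_differentiable_image[OF R_meas(2) derivative integrable])
  have "measure lebesgue (f ` R) \<le> integral R (\<lambda>a. \<bar>det (matrix (f' a))\<bar>)"
    by (rule measure_differentiable_image[OF R_meas(2) derivative integrable])
  also have "\<dots> = measure lebesgue R"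
    by (simp add: abs_det lmeasure_integral[OF R_meas(1)])
  also have "\<dots> = 4 * \<delta> * \<epsilon>"
  proof -
    have "R \<noteq> {}"
      using assms(3,4) by (simp add: R_def interval_ne_empty_cart forall_2)
    then show ?thesis
      by (simp add: R_def content_cbox_cart UNIV_2)
  qed
  finally show "measure lebesgue (graph_strip z p n \<phi> \<delta> \<epsilon>) \<le> 4 * \<delta> * \<epsilon>"
    by (simp add: strip_eq)
qed

section \<open>Moments of the kernel\<close>

definition moment :: "real \<Rightarrow> 'a::euclidean_space \<Rightarrow> 'a \<Rightarrow> 'a \<Rightarrow> 'a \<Rightarrow> real" where
  "moment \<delta> x u v y = kernel \<delta> (norm (y - x)) * ((y - x) \<bullet> u) * ((y - x) \<bullet> v)"

lemma abs_moment_le: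
  assumes "0 \<le> \<delta>"
  shows "\<bar>moment \<delta> x u v y\<bar> \<le> \<delta> * (norm u * norm v)"
proof -
  define h where "h = y - x"
  have "\<bar>moment \<delta> x u v y\<bar> = kernel \<delta> (norm h) * (\<bar>h \<bullet> u\<bar> * \<bar>h \<bullet> v\<bar>)"
    by (simp add: moment_def h_def abs_mult kernel_def)
  also have "\<dots> \<le> kernel \<delta> (norm h) * ((norm h * norm u) * (norm h * norm v))"
    by (intro mult_left_mono mult_mono Cauchy_Schwarz_ineq2) (auto simp: kernel_def)
  also have "\<dots> = (kernel \<delta> (norm h) * (norm h)\<^sup>2) * (norm u * norm v)"
    by (simp add: power2_eq_square mult_ac)
  also have "\<dots> \<le> \<delta> * (norm u * norm v)"
    using assms by (intro mult_right_mono) (auto simp: kernel_def power2_eq_square)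
  finally show ?thesis .
qed

lemma moment_absolutely_integrable:
  assumes "0 \<le> \<delta>" "S \<in> lmeasurable"
  shows "moment \<delta> x u v absolutely_integrable_on S"
proof (rule measurable_bounded_by_integrable_imp_absolutely_integrable)
  have "moment \<delta> x u v \<in> borel_measurable borel"
    unfolding moment_def kernel_def by measurable
  then show "moment \<delta> x u v \<in> borel_measurable (lebesgue_on S)"
    by (intro measurable_restrict_space1 measurable_completion) simp
  show "(\<lambda>_. \<delta> * (norm u * norm v)) integrable_on S"
    using assms(2) by (simp add: integrable_on_const)
qed (use assms abs_moment_le in auto)

lemma moment_integrable:
  "0 \<le> \<delta> \<Longrightarrow> S \<in> lmeasurable \<Longrightarrow> moment \<delta> x u v integrable_on S"
  using moment_absolutely_integrable unfolding absolutely_integrable_on_def by blast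

lemma integral_moment_ge:
  assumes "0 < \<delta>" "0 < r" "S \<in> lmeasurable" "B \<in> lmeasurable" "B \<subseteq> S \<inter> cball x \<delta>"
    and far: "\<And>y. y \<in> B \<Longrightarrow> r \<le> \<bar>(y - x) \<bullet> v\<bar>"
  shows "r\<^sup>2 / \<delta> * measure lebesgue B \<le> integral S (moment \<delta> x v v)"
proof -
  have "r\<^sup>2 / \<delta> \<le> moment \<delta> x v v y" if "y \<in> B" for y
  proof -
    have norm_bounds: "0 < norm (y - x)" "norm (y - x) \<le> \<delta>"
      using far[OF that] assms(2,5) that by (auto simp: dist_norm norm_minus_commute)
    have "r\<^sup>2 \<le> ((y - x) \<bullet> v)\<^sup>2"
      using far[OF that] assms(2) by (intro abs_le_square_iff[THEN iffD1]) simp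
    then have "r\<^sup>2 / \<delta> \<le> ((y - x) \<bullet> v)\<^sup>2 / norm (y - x)"
      using norm_bounds by (intro frac_le) auto
    then show ?thesis
      using norm_bounds by (simp add: moment_def kernel_def power2_eq_square)
  qed
  then have "integral B (\<lambda>_. r\<^sup>2 / \<delta>) \<le> integral B (moment \<delta> x v v)"
    using assms(1,4) by (intro integral_le) (auto simp: integrable_on_const moment_integrable)
  also have "\<dots> \<le> integral S (moment \<delta> x v v)"
    using assms(1,3,4,5)
    by (intro integral_subset_le) (auto simp: moment_integrable moment_def kernel_def)
  finally show ?thesis
    by (simp add: integral_const_lmeasurable[OF assms(4)])
qed

lemma moment_reflection:
  assumes "orthonormal_frame p n"
  shows "moment \<delta> x p n (x + reflection p (y - x)) = - moment \<delta> x p n y"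
  using assms reflection_inner_frame[OF assms]
  by (simp add: moment_def orthonormal_frame_def norm_reflection)

lemma integral_moment_symmetric_eq_0:
  fixes p n :: "real^2"
  assumes "0 \<le> \<delta>" "S \<in> lmeasurable" and frame: "orthonormal_frame p n"
    and sym: "\<And>y. y \<in> S \<Longrightarrow> x + reflection p (y - x) \<in> S"
  shows "integral S (moment \<delta> x p n) = 0"
proof (rule integral_odd_eq_0)
  have norm_p: "norm p = 1"
    using frame by (simp add: orthonormal_frame_def)
  then show "orthogonal_transformation (reflection p)"
    by (rule orthogonal_transformation_reflection)
  show "(\<lambda>y. x + reflection p (y - x)) ` S = S"
  proof (intro equalityI subsetI)
    fix y assume "y \<in> S"
    moreover have "y = x + reflection p (x + reflection p (y - x) - x)"
      by (simp add: reflection_reflection[OF norm_p])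
    ultimately show "y \<in> (\<lambda>y. x + reflection p (y - x)) ` S"
      using sym by blast
  qed (use sym in auto)
  show "S \<in> sets lebesgue"
    using assms(2) by (rule fmeasurableD)
  show "moment \<delta> x p n absolutely_integrable_on S"
    using assms(1,2) by (rule moment_absolutely_integrable)
  show "moment \<delta> x p n (x + reflection p (y - x)) = - moment \<delta> x p n y" for y
    by (rule moment_reflection[OF frame])
qed (rule refl)

lemma Amat_nth_eq_acoef: "Amat \<Omega> \<delta> x $ i $ j = acoef \<Omega> \<delta> x (axis i 1) (axis j 1)"
  by (simp add: Amat_def acoef_def inner_axis)

lemma acoef_eq_integral_moment:
  "acoef \<Omega> \<delta> x u v = 2 / mvol \<delta> * integral (ball x \<delta> \<inter> \<Omega>) (moment \<delta> x u v)"
  by (simp add: acoef_def moment_def[abs_def])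

lemma moment_expand_axis:
  fixes u v :: "real^'n"
  shows "moment \<delta> x u v y
    = (\<Sum>i\<in>UNIV. \<Sum>j\<in>UNIV. u$i * v$j * moment \<delta> x (axis i 1) (axis j 1) y)"
proof -
  have expand: "h \<bullet> a = (\<Sum>i\<in>UNIV. a$i * (h \<bullet> axis i 1))" for h a :: "real^'n"
    by (simp add: inner_axis) (simp add: inner_vec_def mult.commute)
  show ?thesis
    unfolding moment_def expand[of _ u] expand[of _ v]
    by (simp add: sum_product sum_distrib_left mult_ac)
qed

lemma inner_matrix_vector_mult_sum:
  fixes A :: "real^'n^'m"
  shows "u \<bullet> (A *v v) = (\<Sum>i\<in>UNIV. \<Sum>j\<in>UNIV. u$i * v$j * A$i$j)"
  by (simp add: inner_vec_def matrix_vector_mult_def sum_distrib_left mult_ac)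

lemma acoef_eq_inner_Amat:
  assumes "\<Omega> \<in> sets lebesgue" "0 \<le> \<delta>"
  shows "acoef \<Omega> \<delta> x u v = u \<bullet> (Amat \<Omega> \<delta> x *v v)"
proof -
  define S where "S = ball x \<delta> \<inter> \<Omega>"
  define c where "c = 2 / mvol \<delta>"
  have "S \<in> lmeasurable"
    unfolding S_def using assms(1) by (simp add: fmeasurable_Int_fmeasurable)
  then have integrable: "moment \<delta> x a b integrable_on S" for a b
    using assms(2) by (intro moment_integrable)
  have "integral S (moment \<delta> x u v)
      = integral S (\<lambda>y. \<Sum>i\<in>UNIV. \<Sum>j\<in>UNIV. u$i * v$j * moment \<delta> x (axis i 1) (axis j 1) y)"
    by (simp only: moment_expand_axis[of \<delta> x u v, abs_def])
  also have "\<dots> = (\<Sum>i\<in>UNIV. \<Sum>j\<in>UNIV. u$i * v$j * integral S (moment \<delta> x (axis i 1) (axis j 1)))"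
    using integrable by (simp add: integral_sum integrable_sum integrable_on_mult_right)
  finally have "c * integral S (moment \<delta> x u v)
      = (\<Sum>i\<in>UNIV. \<Sum>j\<in>UNIV. u$i * v$j * (c * integral S (moment \<delta> x (axis i 1) (axis j 1))))"
    by (simp add: sum_distrib_left mult_ac)
  then show ?thesis
    by (simp only: inner_matrix_vector_mult_sum Amat_nth_eq_acoef acoef_eq_integral_moment
        S_def c_def)
qed

lemma transpose_Amat: "transpose (Amat \<Omega> \<delta> x) = Amat \<Omega> \<delta> x"
  by (simp add: vec_eq_iff transpose_def Amat_def mult_ac)

section \<open>Boundaries that are parabolic to third order\<close>

lemma C3_on_continuous_on: "C3_on S g \<Longrightarrow> continuous_on S g"
  unfolding C3_on_def by (blast intro: DERIV_continuous_on has_field_derivative_at_within)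

lemma Taylor_cubic_remainder:
  fixes g g1 g2 g3 :: "real \<Rightarrow> real"
  assumes derivatives: "\<And>t. t \<in> {l..u} \<Longrightarrow> (g has_real_derivative g1 t) (at t)"
      "\<And>t. t \<in> {l..u} \<Longrightarrow> (g1 has_real_derivative g2 t) (at t)"
      "\<And>t. t \<in> {l..u} \<Longrightarrow> (g2 has_real_derivative g3 t) (at t)"
    and bound: "\<And>t. t \<in> {l..u} \<Longrightarrow> \<bar>g3 t\<bar> \<le> M"
    and mem: "a \<in> {l..u}" "b \<in> {l..u}"
  shows "\<bar>g b - (g a + g1 a * (b - a) + g2 a / 2 * (b - a)\<^sup>2)\<bar> \<le> M / 6 * \<bar>b - a\<bar> ^ 3"
proof (cases "a = b")
  case False
  define diff where "diff = (\<lambda>m. [g, g1, g2, g3] ! m)"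
  have "\<exists>t. (if b < a then b < t \<and> t < a else a < t \<and> t < b) \<and>
      g b = (\<Sum>m<3. diff m a / fact m * (b - a) ^ m) + diff 3 t / fact 3 * (b - a) ^ 3"
  proof (rule Taylor)
    show "\<forall>m t. m < 3 \<and> l \<le> t \<and> t \<le> u \<longrightarrow> (diff m has_real_derivative diff (Suc m) t) (at t)"
      using derivatives by (auto simp: diff_def less_Suc_eq numeral_3_eq_3)
  qed (use mem False in \<open>auto simp: diff_def\<close>)
  then obtain t where between: "if b < a then b < t \<and> t < a else a < t \<and> t < b"
    and expansion: "g b = (\<Sum>m<3. diff m a / fact m * (b - a) ^ m) + diff 3 t / fact 3 * (b - a) ^ 3"
    by blast
  have "t \<in> {l..u}"
    using between mem by (auto split: if_splits)
  have "\<bar>g b - (g a + g1 a * (b - a) + g2 a / 2 * (b - a)\<^sup>2)\<bar> = \<bar>g3 t / 6 * (b - a) ^ 3\<bar>"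
    using expansion by (simp add: diff_def eval_nat_numeral)
  also have "\<dots> = \<bar>g3 t\<bar> / 6 * \<bar>b - a\<bar> ^ 3"
    by (simp add: abs_mult power_abs)
  also have "\<dots> \<le> M / 6 * \<bar>b - a\<bar> ^ 3"
    using bound[OF \<open>t \<in> {l..u}\<close>] by (intro mult_right_mono) auto
  finally show ?thesis .
qed simp

lemma C3_on_Taylor_uniform:
  assumes g_C3: "C3_on S g" and subset: "{l..u} \<subseteq> S"
  obtains g1 g2 L where "0 \<le> L"
    and "\<And>a. a \<in> {l..u} \<Longrightarrow> (g has_real_derivative g1 a) (at a)"
    and "\<And>a. a \<in> {l..u} \<Longrightarrow> \<bar>g2 a\<bar> \<le> L"
    and "\<And>a b. a \<in> {l..u} \<Longrightarrow> b \<in> {l..u} \<Longrightarrow>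
      \<bar>g b - (g a + g1 a * (b - a) + g2 a * (b - a)\<^sup>2)\<bar> \<le> L * \<bar>b - a\<bar> ^ 3"
proof -
  obtain g1 g2 g3 where derivatives: "\<And>t. t \<in> S \<Longrightarrow> (g has_real_derivative g1 t) (at t)"
      "\<And>t. t \<in> S \<Longrightarrow> (g1 has_real_derivative g2 t) (at t)"
      "\<And>t. t \<in> S \<Longrightarrow> (g2 has_real_derivative g3 t) (at t)"
    and g3_continuous: "continuous_on S g3"
    using g_C3 unfolding C3_on_def by blast
  have g2_continuous: "continuous_on S g2"
    by (rule DERIV_continuous_on[OF has_field_derivative_at_within[OF derivatives(3)]])
  have "bounded (g2 ` {l..u})" "bounded (g3 ` {l..u})"
    using continuous_on_subset[OF g2_continuous subset]
      continuous_on_subset[OF g3_continuous subset]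
    by (auto intro!: compact_imp_bounded compact_continuous_image)
  then obtain L2 L3 where L2_bound: "0 < L2" "\<And>a. a \<in> {l..u} \<Longrightarrow> \<bar>g2 a\<bar> \<le> L2"
    and L3_bound: "0 < L3" "\<And>a. a \<in> {l..u} \<Longrightarrow> \<bar>g3 a\<bar> \<le> L3"
    unfolding bounded_pos by auto
  show thesis
  proof
    show "0 \<le> L2 + L3"
      using L2_bound(1) L3_bound(1) by simp
    show "(g has_real_derivative g1 a) (at a)" if "a \<in> {l..u}" for a
      using derivatives(1) subset that by blast
    show "\<bar>g2 a / 2\<bar> \<le> L2 + L3" if "a \<in> {l..u}" for a
      using L2_bound(2)[OF that] L3_bound(1) by simp
    show "\<bar>g b - (g a + g1 a * (b - a) + g2 a / 2 * (b - a)\<^sup>2)\<bar> \<le> (L2 + L3) * \<bar>b - a\<bar> ^ 3"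
      if "a \<in> {l..u}" "b \<in> {l..u}" for a b
    proof -
      have "\<bar>g b - (g a + g1 a * (b - a) + g2 a / 2 * (b - a)\<^sup>2)\<bar> \<le> L3 / 6 * \<bar>b - a\<bar> ^ 3"
        by (rule Taylor_cubic_remainder[of l u g g1 g2 g3])
          (use derivatives L3_bound(2) subset that in auto)
      also have "\<dots> \<le> (L2 + L3) * \<bar>b - a\<bar> ^ 3"
        using L2_bound(1) L3_bound(1) by (intro mult_right_mono) auto
      finally show ?thesis .
    qed
  qed
qed

lemma C3_chart_frontier_on_graph:
  assumes "open \<Omega>" and chart: "C3_chart \<Omega> z0 r e1 e2 g" and z_mem: "z \<in> frontier \<Omega>" "z \<in> ball z0 r"
  shows "(z - z0) \<bullet> e2 = g ((z - z0) \<bullet> e1)"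
proof -
  define height where "height = (\<lambda>y. (y - z0) \<bullet> e2 - g ((y - z0) \<bullet> e1))"
  have side: "\<And>y. y \<in> ball z0 r \<Longrightarrow> y \<in> \<Omega> \<longleftrightarrow> height y < 0"
    and norm_e1: "norm e1 = 1" and g_C3: "C3_on {-r<..<r} g"
    using chart unfolding C3_chart_def height_def by auto
  have "(y - z0) \<bullet> e1 \<in> {-r<..<r}" if "y \<in> ball z0 r" for y
    using abs_inner_le_norm[OF norm_e1, of "y - z0"] that
    by (auto simp: dist_norm norm_minus_commute)
  then have "continuous_on (ball z0 r) height"
    unfolding height_def
    by (intro continuous_intros continuous_on_compose2[OF C3_on_continuous_on[OF g_C3]]) auto
  then have "open (ball z0 r \<inter> height -` {0<..})"
    by (intro continuous_open_preimage) auto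
  moreover have "ball z0 r \<inter> height -` {0<..} \<inter> \<Omega> = {}"
    using side by force
  ultimately have "ball z0 r \<inter> height -` {0<..} \<inter> closure \<Omega> = {}"
    by (simp add: open_Int_closure_eq_empty)
  moreover have "z \<notin> \<Omega>" "z \<in> closure \<Omega>"
    using \<open>open \<Omega>\<close> z_mem(1) by (auto simp: frontier_def interior_open)
  ultimately have "height z = 0"
    using side[OF z_mem(2)] z_mem(2) by force
  then show ?thesis
    by (simp add: height_def)
qed

definition graph_normal :: "'a::real_inner \<Rightarrow> 'a \<Rightarrow> real \<Rightarrow> 'a" where
  "graph_normal e1 e2 d = (1 / sqrt (1 + d\<^sup>2)) *\<^sub>R (e2 - d *\<^sub>R e1)"

lemma norm_graph_normal:
  assumes "orthonormal_frame e1 e2"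
  shows "norm (graph_normal e1 e2 d) = 1"
proof -
  have "0 < 1 + d\<^sup>2"
    by (simp add: add_pos_nonneg)
  moreover have "(e2 - d *\<^sub>R e1) \<bullet> (e2 - d *\<^sub>R e1) = 1 + d\<^sup>2"
    using orthonormal_frame_inner[OF assms] by (simp add: inner_diff power2_eq_square)
  ultimately show ?thesis
    by (simp add: graph_normal_def norm_eq_sqrt_inner[of "e2 - d *\<^sub>R e1"])
qed

definition parabolic_region :: "real^2 \<Rightarrow> real^2 \<Rightarrow> real \<Rightarrow> (real^2) set" where
  "parabolic_region z n \<kappa> = {y. (y - z) \<bullet> n < \<kappa> * ((y - z) \<bullet> tangent_of n)\<^sup>2}"

text \<open>Phrased through membership rather than as a graph over the tangent line, which spares the
  implicit function theorem.\<close>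
definition parabolic_boundary_at :: "(real^2) set \<Rightarrow> real^2 \<Rightarrow> real^2 \<Rightarrow> real \<Rightarrow> real \<Rightarrow> bool" where
  "parabolic_boundary_at \<Omega> z n \<rho> C \<longleftrightarrow> norm n = 1 \<and> (\<exists>\<kappa>. \<bar>\<kappa>\<bar> \<le> C \<and> (\<forall>y\<in>ball z \<rho>.
     (y \<in> \<Omega> \<longleftrightarrow> y \<in> parabolic_region z n \<kappa>) \<or>
     \<bar>(y - z) \<bullet> n - \<kappa> * ((y - z) \<bullet> tangent_of n)\<^sup>2\<bar> \<le> C * norm (y - z) ^ 3))"

lemma less_perturbed_iff_or_close:
  fixes u v \<eta> R :: real
  assumes "\<bar>\<eta>\<bar> \<le> 1/2"
  shows "(u * (1 + \<eta>) < v + R \<longleftrightarrow> u < v) \<or> \<bar>u - v\<bar> \<le> 2 * (\<bar>R\<bar> + \<bar>v * \<eta>\<bar>)"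
proof (rule disjCI)
  assume far: "\<not> \<bar>u - v\<bar> \<le> 2 * (\<bar>R\<bar> + \<bar>v * \<eta>\<bar>)"
  have "\<bar>u * \<eta>\<bar> = \<bar>v * \<eta> + (u - v) * \<eta>\<bar>"
    by (simp add: algebra_simps)
  also have "\<dots> \<le> \<bar>v * \<eta>\<bar> + \<bar>u - v\<bar> * \<bar>\<eta>\<bar>"
    using abs_triangle_ineq[of "v * \<eta>" "(u - v) * \<eta>"] by (simp add: abs_mult)
  finally have "2 * \<bar>u * \<eta>\<bar> \<le> 2 * \<bar>v * \<eta>\<bar> + \<bar>u - v\<bar>"
    using assms mult_left_mono[of "2 * \<bar>\<eta>\<bar>" 1 "\<bar>u - v\<bar>"] by simp
  then have "\<bar>R - u * \<eta>\<bar> < \<bar>u - v\<bar>"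
    using far abs_triangle_ineq4[of R "u * \<eta>"] by argo
  then have "u < v + (R - u * \<eta>) \<longleftrightarrow> u < v"
    by linarith
  then show "u * (1 + \<eta>) < v + R \<longleftrightarrow> u < v"
    by (simp add: algebra_simps)
qed

text \<open>With \<open>\<tau> = h \<bullet> e1\<close>, \<open>\<sigma> = h \<bullet> e2\<close> and \<open>t\<close>, \<open>u\<close> the tangential and normal coordinates of
  \<open>h\<close>, computing \<open>\<bar>h\<bar>\<^sup>2\<close> in both frames gives \<open>w\<^sup>2 \<tau>\<^sup>2 = t\<^sup>2 - u (w (\<sigma> + d \<tau>) - u)\<close>. A quadratic
  condition on \<open>\<tau>\<close> thus becomes one on \<open>t\<close>, corrected only by a factor \<open>1 + O(\<bar>h\<bar>)\<close> in front
  of \<open>u\<close>.\<close>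
lemma graph_side_normal_frame_iff:
  fixes e1 e2 h :: "real^2" and d q R :: real
  assumes frame: "orthonormal_frame e1 e2"
  defines "n \<equiv> graph_normal e1 e2 d" and "w \<equiv> sqrt (1 + d\<^sup>2)"
  defines "\<kappa> \<equiv> q / w ^ 3"
  defines "\<eta> \<equiv> \<kappa> * (w * (h \<bullet> e2 + d * (h \<bullet> e1)) - h \<bullet> n)"
  shows "h \<bullet> e2 - d * (h \<bullet> e1) < q * (h \<bullet> e1)\<^sup>2 + R
    \<longleftrightarrow> h \<bullet> n * (1 + \<eta>) < \<kappa> * (h \<bullet> tangent_of n)\<^sup>2 + R / w"
proof -
  define \<tau> \<sigma> u t where "\<tau> = h \<bullet> e1" "\<sigma> = h \<bullet> e2" "u = h \<bullet> n" "t = h \<bullet> tangent_of n"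
  note coordinates = this
  have "norm n = 1"
    unfolding n_def by (rule norm_graph_normal[OF frame])
  have w_facts: "1 \<le> w" "w\<^sup>2 = 1 + d\<^sup>2"
    by (simp_all add: w_def)
  have normal_coordinate: "w * u = \<sigma> - d * \<tau>"
    using w_facts(1)
    by (simp add: coordinates n_def graph_normal_def w_def[symmetric] inner_diff_right)
  have "t\<^sup>2 + u\<^sup>2 = \<tau>\<^sup>2 + \<sigma>\<^sup>2"
    using norm_orthonormal_frame[OF orthonormal_frame_tangent_of[OF \<open>norm n = 1\<close>], of h]
      norm_orthonormal_frame[OF frame, of h] by (simp add: coordinates)
  then have \<tau>_square: "w\<^sup>2 * \<tau>\<^sup>2 = t\<^sup>2 - u * (w * (\<sigma> + d * \<tau>) - u)"
    using normal_coordinate w_facts(2) by algebra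
  have "w * (u * (1 + \<eta>) - \<kappa> * t\<^sup>2) = w * u - \<kappa> * w * (t\<^sup>2 - u * (w * (\<sigma> + d * \<tau>) - u))"
    by (simp add: \<eta>_def coordinates algebra_simps)
  also have "\<dots> = \<sigma> - d * \<tau> - q * \<tau>\<^sup>2"
    unfolding \<tau>_square[symmetric] using w_facts(1) normal_coordinate
    by (simp add: \<kappa>_def power2_eq_square power3_eq_cube)
  finally have "w * (u * (1 + \<eta>) - \<kappa> * t\<^sup>2 - R / w) = \<sigma> - d * \<tau> - q * \<tau>\<^sup>2 - R"
    using w_facts(1) by (simp add: right_diff_distrib)
  then have "\<sigma> - d * \<tau> < q * \<tau>\<^sup>2 + R \<longleftrightarrow> u * (1 + \<eta>) < \<kappa> * t\<^sup>2 + R / w"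
    using w_facts(1) mult_less_0_iff[of w "u * (1 + \<eta>) - \<kappa> * t\<^sup>2 - R / w"] by auto
  then show ?thesis
    by (simp only: coordinates)
qed

lemma abs_graph_side_factor_le:
  fixes e1 e2 h :: "real^2" and d q :: real
  assumes frame: "orthonormal_frame e1 e2"
  defines "w \<equiv> sqrt (1 + d\<^sup>2)"
  shows "\<bar>q / w ^ 3 * (w * (h \<bullet> e2 + d * (h \<bullet> e1)) - h \<bullet> graph_normal e1 e2 d)\<bar> \<le> 3 * \<bar>q\<bar> * norm h"
proof -
  define \<tau> \<sigma> u where "\<tau> = h \<bullet> e1" "\<sigma> = h \<bullet> e2" "u = h \<bullet> graph_normal e1 e2 d"
  note coordinates = this
  have w_bounds: "1 \<le> w" "\<bar>d\<bar> \<le> w"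
    by (simp_all add: w_def real_le_rsqrt)
  have abs_coordinates: "\<bar>\<sigma>\<bar> \<le> norm h" "\<bar>\<tau>\<bar> \<le> norm h" "\<bar>u\<bar> \<le> norm h"
    using frame norm_graph_normal[OF frame]
    by (simp_all add: coordinates orthonormal_frame_def abs_inner_le_norm)
  have "\<bar>\<sigma> + d * \<tau>\<bar> \<le> 1 * \<bar>\<sigma>\<bar> + \<bar>d\<bar> * \<bar>\<tau>\<bar>"
    using abs_triangle_ineq[of \<sigma> "d * \<tau>"] by (simp add: abs_mult)
  also have "\<dots> \<le> w * norm h + w * norm h"
    using abs_coordinates w_bounds by (intro add_mono mult_mono) auto
  finally have "\<bar>w * (\<sigma> + d * \<tau>)\<bar> \<le> w * (2 * w * norm h)"
    using w_bounds(1) by (simp add: abs_mult)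
  moreover have "\<bar>u\<bar> \<le> w\<^sup>2 * norm h"
    using abs_coordinates(3) w_bounds(1) mult_right_mono[of 1 "w\<^sup>2" "norm h"] by simp
  ultimately have "\<bar>w * (\<sigma> + d * \<tau>) - u\<bar> \<le> 3 * w\<^sup>2 * norm h"
    by (simp add: power2_eq_square)
  then have "\<bar>q / w ^ 3 * (w * (\<sigma> + d * \<tau>) - u)\<bar> \<le> \<bar>q / w ^ 3\<bar> * (3 * w\<^sup>2 * norm h)"
    unfolding abs_mult by (intro mult_left_mono) auto
  also have "\<dots> = 3 * \<bar>q\<bar> * norm h / w"
    using w_bounds(1) by (simp add: power2_eq_square power3_eq_cube)
  also have "\<dots> \<le> 3 * \<bar>q\<bar> * norm h / 1"
    using w_bounds(1) by (intro divide_left_mono) auto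
  finally show ?thesis
    by (simp add: coordinates)
qed

lemma abs_graph_curvature_le: "\<bar>q / sqrt (1 + d\<^sup>2) ^ 3\<bar> \<le> \<bar>q\<bar>" for q d :: real
  using divide_left_mono[of 1 "sqrt (1 + d\<^sup>2) ^ 3" "\<bar>q\<bar>"]
  by (simp add: add_pos_nonneg)

lemma graph_side_parabolic:
  fixes e1 e2 h :: "real^2" and d q R L :: real
  assumes frame: "orthonormal_frame e1 e2"
    and q_le: "\<bar>q\<bar> \<le> L" and R_le: "\<bar>R\<bar> \<le> L * norm h ^ 3" and small: "6 * L * norm h \<le> 1"
  defines "n \<equiv> graph_normal e1 e2 d" and "\<kappa> \<equiv> q / sqrt (1 + d\<^sup>2) ^ 3"
  shows "(h \<bullet> e2 - d * (h \<bullet> e1) < q * (h \<bullet> e1)\<^sup>2 + R \<longleftrightarrow> h \<bullet> n < \<kappa> * (h \<bullet> tangent_of n)\<^sup>2)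
    \<or> \<bar>h \<bullet> n - \<kappa> * (h \<bullet> tangent_of n)\<^sup>2\<bar> \<le> (2 * L + 6 * L\<^sup>2) * norm h ^ 3"
proof -
  define w where "w = sqrt (1 + d\<^sup>2)"
  define t where "t = h \<bullet> tangent_of n"
  define \<eta> where "\<eta> = \<kappa> * (w * (h \<bullet> e2 + d * (h \<bullet> e1)) - h \<bullet> n)"
  have side: "h \<bullet> e2 - d * (h \<bullet> e1) < q * (h \<bullet> e1)\<^sup>2 + R \<longleftrightarrow> h \<bullet> n * (1 + \<eta>) < \<kappa> * t\<^sup>2 + R / w"
    unfolding n_def \<kappa>_def w_def t_def \<eta>_def by (rule graph_side_normal_frame_iff[OF frame])
  have \<eta>_le_q: "\<bar>\<eta>\<bar> \<le> 3 * \<bar>q\<bar> * norm h"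
    unfolding n_def \<kappa>_def w_def \<eta>_def by (rule abs_graph_side_factor_le[OF frame])
  have "1 \<le> w"
    by (simp add: w_def)
  have "norm (tangent_of n) = 1"
    using orthonormal_frame_tangent_of[OF norm_graph_normal[OF frame, of d]]
    by (simp add: n_def orthonormal_frame_def)
  then have "t\<^sup>2 \<le> (norm h)\<^sup>2"
    unfolding t_def by (intro abs_le_square_iff[THEN iffD1]) (simp add: abs_inner_le_norm)
  have "0 \<le> L"
    using q_le by linarith
  have "3 * \<bar>q\<bar> * norm h \<le> 3 * L * norm h"
    using q_le by (intro mult_right_mono) auto
  then have \<eta>_bounds: "\<bar>\<eta>\<bar> \<le> 3 * L * norm h" "\<bar>\<eta>\<bar> \<le> 1/2"
    using \<eta>_le_q small by linarith+
  have "\<bar>R / w\<bar> \<le> L * norm h ^ 3 / 1"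
    unfolding abs_divide using \<open>1 \<le> w\<close> R_le by (intro frac_le) auto
  moreover have "\<bar>\<kappa>\<bar> \<le> L"
    using q_le abs_graph_curvature_le[of q d] unfolding \<kappa>_def by linarith
  then have "\<bar>\<kappa> * t\<^sup>2 * \<eta>\<bar> \<le> L * (norm h)\<^sup>2 * (3 * L * norm h)"
    unfolding abs_mult using \<open>0 \<le> L\<close> \<open>t\<^sup>2 \<le> (norm h)\<^sup>2\<close> \<eta>_bounds(1) by (intro mult_mono) auto
  ultimately have "2 * (\<bar>R / w\<bar> + \<bar>\<kappa> * t\<^sup>2 * \<eta>\<bar>)
      \<le> 2 * (L * norm h ^ 3 + L * (norm h)\<^sup>2 * (3 * L * norm h))"
    by simp
  also have "\<dots> = (2 * L + 6 * L\<^sup>2) * norm h ^ 3"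
    by (simp add: power2_eq_square power3_eq_cube algebra_simps)
  finally show ?thesis
    using less_perturbed_iff_or_close[OF \<eta>_bounds(2), of "h \<bullet> n" "\<kappa> * t\<^sup>2" "R / w"]
    unfolding side t_def by linarith
qed

lemma C3_chart_side_increment:
  assumes "open \<Omega>" and chart: "C3_chart \<Omega> z0 r e1 e2 g"
    and z_mem: "z \<in> frontier \<Omega>" "z \<in> ball z0 r" and y_mem: "y \<in> ball z0 r"
  defines "a \<equiv> (z - z0) \<bullet> e1"
  shows "y \<in> \<Omega> \<longleftrightarrow> (y - z) \<bullet> e2 < g (a + (y - z) \<bullet> e1) - g a"
proof -
  have "(y - z0) \<bullet> e1 = a + (y - z) \<bullet> e1" "(y - z0) \<bullet> e2 = (y - z) \<bullet> e2 + g a"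
    unfolding a_def C3_chart_frontier_on_graph[OF assms(1) chart z_mem, symmetric]
    by (simp_all add: inner_diff_left)
  then show ?thesis
    using chart y_mem unfolding C3_chart_def by auto
qed

lemma C3_chart_side_Taylor:
  assumes "open \<Omega>" and chart: "C3_chart \<Omega> z0 r e1 e2 g"
    and z_mem: "z \<in> frontier \<Omega>" "z \<in> ball z0 r" and y_mem: "y \<in> ball z0 r" and "0 \<le> L"
  defines "a \<equiv> (z - z0) \<bullet> e1" and "h \<equiv> y - z"
  assumes Taylor: "\<And>\<tau>. \<bar>\<tau>\<bar> \<le> norm h \<Longrightarrow> \<bar>g (a + \<tau>) - (g a + d * \<tau> + q * \<tau>\<^sup>2)\<bar> \<le> L * \<bar>\<tau>\<bar> ^ 3"
  obtains R where "\<bar>R\<bar> \<le> L * norm h ^ 3"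
    and "y \<in> \<Omega> \<longleftrightarrow> h \<bullet> e2 - d * (h \<bullet> e1) < q * (h \<bullet> e1)\<^sup>2 + R"
proof
  define R where "R = g (a + h \<bullet> e1) - (g a + d * (h \<bullet> e1) + q * (h \<bullet> e1)\<^sup>2)"
  have abs_h_e1: "\<bar>h \<bullet> e1\<bar> \<le> norm h"
    using chart by (simp add: C3_chart_def abs_inner_le_norm)
  then have "\<bar>R\<bar> \<le> L * \<bar>h \<bullet> e1\<bar> ^ 3"
    unfolding R_def by (rule Taylor)
  also have "\<dots> \<le> L * norm h ^ 3"
    using abs_h_e1 \<open>0 \<le> L\<close> by (intro mult_left_mono power_mono) auto
  finally show "\<bar>R\<bar> \<le> L * norm h ^ 3" .
  have "y \<in> \<Omega> \<longleftrightarrow> h \<bullet> e2 < g (a + h \<bullet> e1) - g a"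
    unfolding a_def h_def by (rule C3_chart_side_increment[OF assms(1) chart z_mem y_mem])
  also have "\<dots> \<longleftrightarrow> h \<bullet> e2 - d * (h \<bullet> e1) < q * (h \<bullet> e1)\<^sup>2 + R"
    by (simp add: R_def algebra_simps)
  finally show "y \<in> \<Omega> \<longleftrightarrow> h \<bullet> e2 - d * (h \<bullet> e1) < q * (h \<bullet> e1)\<^sup>2 + R" .
qed

lemma parabolic_boundary_at_if_Taylor:
  assumes "open \<Omega>" and chart: "C3_chart \<Omega> z0 r e1 e2 g"
    and z_mem: "z \<in> frontier \<Omega>" "0 < \<rho>" "ball z \<rho> \<subseteq> ball z0 r"
    and L_bounds: "\<bar>q\<bar> \<le> L" "6 * L * \<rho> \<le> 1"
  defines "a \<equiv> (z - z0) \<bullet> e1"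
  assumes Taylor: "\<And>\<tau>. \<bar>\<tau>\<bar> < \<rho> \<Longrightarrow> \<bar>g (a + \<tau>) - (g a + d * \<tau> + q * \<tau>\<^sup>2)\<bar> \<le> L * \<bar>\<tau>\<bar> ^ 3"
  shows "parabolic_boundary_at \<Omega> z (graph_normal e1 e2 d) \<rho> (2 * L + 6 * L\<^sup>2)"
proof -
  define n where "n = graph_normal e1 e2 d"
  define \<kappa> where "\<kappa> = q / sqrt (1 + d\<^sup>2) ^ 3"
  have frame: "orthonormal_frame e1 e2"
    using chart by (simp add: C3_chart_def orthonormal_frame_def)
  have "0 \<le> L"
    using L_bounds(1) by linarith
  have "(y \<in> \<Omega> \<longleftrightarrow> y \<in> parabolic_region z n \<kappa>) \<or>
      \<bar>(y - z) \<bullet> n - \<kappa> * ((y - z) \<bullet> tangent_of n)\<^sup>2\<bar> \<le> (2 * L + 6 * L\<^sup>2) * norm (y - z) ^ 3"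
    if y_mem: "y \<in> ball z \<rho>" for y
  proof -
    have near: "norm (y - z) < \<rho>"
      using y_mem by (simp add: dist_norm norm_minus_commute)
    have "z \<in> ball z0 r" "y \<in> ball z0 r"
      using subsetD[OF z_mem(3), of z] subsetD[OF z_mem(3) y_mem] z_mem(2) by simp_all
    then obtain R where R_le: "\<bar>R\<bar> \<le> L * norm (y - z) ^ 3"
      and side: "y \<in> \<Omega> \<longleftrightarrow> (y - z) \<bullet> e2 - d * ((y - z) \<bullet> e1) < q * ((y - z) \<bullet> e1)\<^sup>2 + R"
      using near Taylor \<open>0 \<le> L\<close> unfolding a_def
      by (elim C3_chart_side_Taylor[OF assms(1) chart z_mem(1)]) auto
    have "6 * L * norm (y - z) \<le> 6 * L * \<rho>"
      using near \<open>0 \<le> L\<close> by (intro mult_left_mono) auto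
    then show ?thesis
      using graph_side_parabolic[OF frame L_bounds(1) R_le, of d] L_bounds(2)
      unfolding side n_def \<kappa>_def parabolic_region_def mem_Collect_eq by linarith
  qed
  moreover have "\<bar>\<kappa>\<bar> \<le> L"
    using abs_graph_curvature_le[of q d] L_bounds(1) unfolding \<kappa>_def by linarith
  then have "\<bar>\<kappa>\<bar> \<le> 2 * L + 6 * L\<^sup>2"
    using \<open>0 \<le> L\<close> by (simp add: add_increasing2)
  ultimately show ?thesis
    unfolding parabolic_boundary_at_def n_def using norm_graph_normal[OF frame] by blast
qed

lemma C3_chart_parabolic_boundary:
  assumes "open \<Omega>" and chart: "C3_chart \<Omega> z0 r e1 e2 g"
  obtains \<rho> C where "0 < \<rho>"
    and "\<And>z. z \<in> frontier \<Omega> \<Longrightarrow> z \<in> ball z0 \<rho> \<Longrightarrow>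
      \<exists>d. (g has_real_derivative d) (at ((z - z0) \<bullet> e1)) \<and>
          parabolic_boundary_at \<Omega> z (graph_normal e1 e2 d) \<rho> C"
proof -
  have r_pos: "0 < r" and norm_e1: "norm e1 = 1" and g_C3: "C3_on {-r<..<r} g"
    using chart by (simp_all add: C3_chart_def)
  have "{-(r/2)..r/2} \<subseteq> {-r<..<r}"
    using r_pos by auto
  from C3_on_Taylor_uniform[OF g_C3 this] obtain g1 g2 L where L_nonneg: "0 \<le> L"
    and g1_derivative: "\<And>a. a \<in> {-(r/2)..r/2} \<Longrightarrow> (g has_real_derivative g1 a) (at a)"
    and g2_le: "\<And>a. a \<in> {-(r/2)..r/2} \<Longrightarrow> \<bar>g2 a\<bar> \<le> L"
    and Taylor: "\<And>a b. a \<in> {-(r/2)..r/2} \<Longrightarrow> b \<in> {-(r/2)..r/2} \<Longrightarrow>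
      \<bar>g b - (g a + g1 a * (b - a) + g2 a * (b - a)\<^sup>2)\<bar> \<le> L * \<bar>b - a\<bar> ^ 3"
    by metis
  define \<rho> where "\<rho> = min (r/4) (1 / (6 * L + 1))"
  have \<rho>_bounds: "0 < \<rho>" "\<rho> \<le> r/4"
    using r_pos L_nonneg by (simp_all add: \<rho>_def)
  have "\<rho> * (6 * L + 1) \<le> 1 / (6 * L + 1) * (6 * L + 1)"
    using L_nonneg by (intro mult_right_mono) (simp_all add: \<rho>_def)
  then have L_\<rho>_le: "6 * L * \<rho> \<le> 1"
    using L_nonneg \<rho>_bounds(1) by (simp add: algebra_simps)
  show thesis
  proof (rule that[OF \<rho>_bounds(1)])
    fix z assume z_mem: "z \<in> frontier \<Omega>" "z \<in> ball z0 \<rho>"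
    define a where "a = (z - z0) \<bullet> e1"
    have "\<bar>a\<bar> \<le> r/4"
      using abs_inner_le_norm[OF norm_e1, of "z - z0"] z_mem(2) \<rho>_bounds(2)
      by (simp add: a_def dist_norm norm_minus_commute)
    then have a_mem: "a \<in> {-(r/2)..r/2}" "\<And>\<tau>. \<bar>\<tau>\<bar> < \<rho> \<Longrightarrow> a + \<tau> \<in> {-(r/2)..r/2}"
      using \<rho>_bounds by auto
    have "ball z \<rho> \<subseteq> ball z0 r"
      using z_mem(2) \<rho>_bounds
      by (intro ball_subset_ball_iff[THEN iffD2] disjI1) (simp add: dist_commute)
    then have "parabolic_boundary_at \<Omega> z (graph_normal e1 e2 (g1 a)) \<rho> (2 * L + 6 * L\<^sup>2)"
      using a_mem Taylor[OF a_mem(1) a_mem(2)] g2_le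
      by (intro parabolic_boundary_at_if_Taylor[OF assms(1) chart z_mem(1) \<rho>_bounds(1) _ _ L_\<rho>_le])
        (auto simp: a_def)
    then show "\<exists>d. (g has_real_derivative d) (at ((z - z0) \<bullet> e1)) \<and>
        parabolic_boundary_at \<Omega> z (graph_normal e1 e2 d) \<rho> (2 * L + 6 * L\<^sup>2)"
      using g1_derivative[OF a_mem(1)] unfolding a_def by blast
  qed
qed

lemma parabolic_boundary_at_nonneg: "parabolic_boundary_at \<Omega> z n \<rho> C \<Longrightarrow> 0 \<le> C"
  unfolding parabolic_boundary_at_def by (meson abs_ge_zero order_trans)

lemma parabolic_boundary_at_mono:
  assumes "parabolic_boundary_at \<Omega> z n \<rho> C" "\<rho>' \<le> \<rho>" "C \<le> C'"
  shows "parabolic_boundary_at \<Omega> z n \<rho>' C'"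
proof -
  have "C * norm (y - z) ^ 3 \<le> C' * norm (y - z) ^ 3" for y
    using assms(3) by (intro mult_right_mono) auto
  moreover have "ball z \<rho>' \<subseteq> ball z \<rho>"
    using assms(2) by (rule subset_ball)
  ultimately show ?thesis
    using assms(1,3) unfolding parabolic_boundary_at_def by (meson order_trans subsetD)
qed

lemma parabolic_boundary_at_mem_iff:
  assumes "parabolic_boundary_at \<Omega> z n \<rho> C" "y \<in> ball z \<rho>"
    and far: "C * (norm (y - z)) ^ 2 + C * norm (y - z) ^ 3 < \<bar>(y - z) \<bullet> n\<bar>"
  shows "y \<in> \<Omega> \<longleftrightarrow> (y - z) \<bullet> n < 0"
proof -
  obtain \<kappa> where norm_n: "norm n = 1" and \<kappa>_le: "\<bar>\<kappa>\<bar> \<le> C"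
    and side: "(y \<in> \<Omega> \<longleftrightarrow> y \<in> parabolic_region z n \<kappa>) \<or>
      \<bar>(y - z) \<bullet> n - \<kappa> * ((y - z) \<bullet> tangent_of n)\<^sup>2\<bar> \<le> C * norm (y - z) ^ 3"
    using assms(1,2) unfolding parabolic_boundary_at_def by blast
  have "((y - z) \<bullet> tangent_of n)\<^sup>2 \<le> (norm (y - z))\<^sup>2"
    using norm_orthonormal_frame[OF orthonormal_frame_tangent_of[OF norm_n], of "y - z"] by simp
  then have "\<bar>\<kappa> * ((y - z) \<bullet> tangent_of n)\<^sup>2\<bar> \<le> C * (norm (y - z))\<^sup>2"
    unfolding abs_mult using \<kappa>_le by (intro mult_mono) auto
  moreover have "0 \<le> C * norm (y - z) ^ 3"
    using \<kappa>_le by simp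
  ultimately show ?thesis
    using side far unfolding parabolic_region_def mem_Collect_eq by linarith
qed

lemma parabolic_boundary_at_eventually_ray:
  assumes "parabolic_boundary_at \<Omega> z n \<rho> C" "0 < \<rho>" "v \<bullet> n \<noteq> 0"
  shows "\<forall>\<^sub>F t in at_right 0. z + t *\<^sub>R v \<in> \<Omega> \<longleftrightarrow> v \<bullet> n < 0"
proof -
  have "((\<lambda>t. C * (t * (norm v)\<^sup>2) + C * (t\<^sup>2 * norm v ^ 3))
      \<longlongrightarrow> C * (0 * (norm v)\<^sup>2) + C * (0\<^sup>2 * norm v ^ 3)) (at_right 0)"
    by (intro tendsto_intros)
  then have "\<forall>\<^sub>F t in at_right 0. C * (t * (norm v)\<^sup>2) + C * (t\<^sup>2 * norm v ^ 3) < \<bar>v \<bullet> n\<bar>"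
    using assms(3) by (intro order_tendstoD(2)) auto
  moreover have "((\<lambda>t. t * norm v) \<longlongrightarrow> 0 * norm v) (at_right 0)"
    by (intro tendsto_intros)
  then have "\<forall>\<^sub>F t in at_right 0. t * norm v < \<rho>"
    using assms(2) by (intro order_tendstoD(2)) auto
  moreover have "\<forall>\<^sub>F t in at_right (0::real). 0 < t"
    by (simp add: eventually_at_right_less)
  ultimately show ?thesis
  proof eventually_elim
    case (elim t)
    have "t * (C * (t * (norm v)\<^sup>2) + C * (t\<^sup>2 * norm v ^ 3)) < t * \<bar>v \<bullet> n\<bar>"
      using elim(1,3) by (rule mult_strict_left_mono)
    then have "z + t *\<^sub>R v \<in> \<Omega> \<longleftrightarrow> (z + t *\<^sub>R v - z) \<bullet> n < 0"
      using elim(2,3)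
      by (intro parabolic_boundary_at_mem_iff[OF assms(1)])
        (simp_all add: dist_norm abs_mult power_mult_distrib algebra_simps
          power2_eq_square power3_eq_cube)
    then show ?case
      using elim(3) by (simp add: mult_less_0_iff)
  qed
qed

lemma parabolic_boundary_at_normal_unique:
  assumes "parabolic_boundary_at \<Omega> z n \<rho> C" "0 < \<rho>"
    and "parabolic_boundary_at \<Omega> z n' \<rho>' C'" "0 < \<rho>'"
  shows "n = n'"
proof (rule ccontr)
  assume "n \<noteq> n'"
  have norms: "n \<bullet> n = 1" "n' \<bullet> n' = 1"
    using assms(1,3) by (simp_all add: parabolic_boundary_at_def norm_eq_1)
  have "0 < (n - n') \<bullet> (n - n')"
    using \<open>n \<noteq> n'\<close> by simp
  then have "n \<bullet> n' < 1"
    using norms by (simp add: inner_diff inner_commute)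
  then have opposite_sides: "(n' - n) \<bullet> n < 0" "0 < (n' - n) \<bullet> n'"
    using norms by (simp_all add: inner_diff_left inner_commute[of n' n])
  have "\<forall>\<^sub>F t in at_right 0. z + t *\<^sub>R (n' - n) \<in> \<Omega> \<longleftrightarrow> (n' - n) \<bullet> n < 0"
    using assms(1,2) opposite_sides(1) by (intro parabolic_boundary_at_eventually_ray) auto
  moreover have "\<forall>\<^sub>F t in at_right 0. z + t *\<^sub>R (n' - n) \<in> \<Omega> \<longleftrightarrow> (n' - n) \<bullet> n' < 0"
    using assms(3,4) opposite_sides(2) by (intro parabolic_boundary_at_eventually_ray) auto
  ultimately have "\<forall>\<^sub>F t in at_right (0::real). False"
    by eventually_elim (use opposite_sides in auto)
  then show False
    by (simp add: trivial_limit_at_right_real)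
qed

lemma outward_normal_parabolic_boundary:
  assumes "open \<Omega>" "z \<in> frontier \<Omega>" "outward_normal \<Omega> z n"
  obtains \<rho> C where "0 < \<rho>" "parabolic_boundary_at \<Omega> z n \<rho> C"
proof -
  obtain r e1 e2 g d where chart: "C3_chart \<Omega> z r e1 e2 g"
    and d_derivative: "(g has_real_derivative d) (at 0)" and n_eq: "n = graph_normal e1 e2 d"
    using assms(3) unfolding outward_normal_def graph_normal_def by blast
  obtain \<rho> C where "0 < \<rho>"
    and parabolic: "\<And>y. y \<in> frontier \<Omega> \<Longrightarrow> y \<in> ball z \<rho> \<Longrightarrow>
      \<exists>d. (g has_real_derivative d) (at ((y - z) \<bullet> e1)) \<and>
          parabolic_boundary_at \<Omega> y (graph_normal e1 e2 d) \<rho> C"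
    using C3_chart_parabolic_boundary[OF assms(1) chart] by blast
  obtain d' where "(g has_real_derivative d') (at 0)"
    and "parabolic_boundary_at \<Omega> z (graph_normal e1 e2 d') \<rho> C"
    using parabolic[of z] \<open>0 < \<rho>\<close> assms(2) by auto
  then show thesis
    using that[of \<rho> C] \<open>0 < \<rho>\<close> DERIV_unique[OF d_derivative] n_eq by blast
qed

lemma outward_normal_locally_parabolic_boundary:
  assumes "open \<Omega>" "C3_boundary \<Omega>" "z0 \<in> frontier \<Omega>"
  obtains \<rho> C where "0 < \<rho>"
    and "\<And>z n. z \<in> frontier \<Omega> \<Longrightarrow> z \<in> ball z0 \<rho> \<Longrightarrow> outward_normal \<Omega> z n \<Longrightarrow>
      parabolic_boundary_at \<Omega> z n \<rho> C"
proof -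
  obtain r e1 e2 g where chart: "C3_chart \<Omega> z0 r e1 e2 g"
    using assms(2,3) unfolding C3_boundary_def by blast
  obtain \<rho> C where "0 < \<rho>"
    and parabolic: "\<And>z. z \<in> frontier \<Omega> \<Longrightarrow> z \<in> ball z0 \<rho> \<Longrightarrow>
      \<exists>d. (g has_real_derivative d) (at ((z - z0) \<bullet> e1)) \<and>
          parabolic_boundary_at \<Omega> z (graph_normal e1 e2 d) \<rho> C"
    using C3_chart_parabolic_boundary[OF assms(1) chart] by blast
  show thesis
  proof (rule that[OF \<open>0 < \<rho>\<close>])
    fix z n assume z_mem: "z \<in> frontier \<Omega>" "z \<in> ball z0 \<rho>" and outward: "outward_normal \<Omega> z n"
    obtain d where d_boundary: "parabolic_boundary_at \<Omega> z (graph_normal e1 e2 d) \<rho> C"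
      using parabolic[OF z_mem] by blast
    obtain \<rho>' C' where "0 < \<rho>'" "parabolic_boundary_at \<Omega> z n \<rho>' C'"
      using outward_normal_parabolic_boundary[OF assms(1) z_mem(1) outward] .
    then have "graph_normal e1 e2 d = n"
      using parabolic_boundary_at_normal_unique[OF d_boundary \<open>0 < \<rho>\<close>] by blast
    then show "parabolic_boundary_at \<Omega> z n \<rho> C"
      using d_boundary by simp
  qed
qed

lemma compact_uniform_parameters:
  fixes P :: "real \<Rightarrow> real \<Rightarrow> 'a::metric_space \<Rightarrow> bool"
  assumes "compact K"
    and mono: "\<And>\<rho> C \<rho>' C' z. P \<rho> C z \<Longrightarrow> \<rho>' \<le> \<rho> \<Longrightarrow> C \<le> C' \<Longrightarrow> P \<rho>' C' z"
    and local: "\<And>z0. z0 \<in> K \<Longrightarrow> \<exists>\<rho>>0. \<exists>C. \<forall>z\<in>K \<inter> ball z0 \<rho>. P \<rho> C z"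
  obtains \<rho> C where "0 < \<rho>" "0 < C" "\<And>z. z \<in> K \<Longrightarrow> P \<rho> C z"
proof -
  obtain \<rho> C where \<rho>_pos: "\<And>z0. z0 \<in> K \<Longrightarrow> 0 < \<rho> z0"
    and P_local: "\<And>z0 z. z0 \<in> K \<Longrightarrow> z \<in> K \<inter> ball z0 (\<rho> z0) \<Longrightarrow> P (\<rho> z0) (C z0) z"
    using local by metis
  obtain D where D_cover: "D \<subseteq> K" "finite D" "K \<subseteq> (\<Union>z\<in>D. ball z (\<rho> z))"
    by (rule compactE_image[OF \<open>compact K\<close>, of K "\<lambda>z. ball z (\<rho> z)"]) (use \<rho>_pos in auto)
  define \<rho>0 where "\<rho>0 = Min (insert 1 (\<rho> ` D))"
  define C0 where "C0 = Max (insert 1 (C ` D))"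
  show thesis
  proof
    show "0 < \<rho>0"
      using D_cover \<rho>_pos by (auto simp: \<rho>0_def)
    show "0 < C0"
      using D_cover by (simp add: C0_def Max_gr_iff)
    show "P \<rho>0 C0 z" if z_mem: "z \<in> K" for z
    proof -
      obtain z0 where z0_mem: "z0 \<in> D" "z \<in> ball z0 (\<rho> z0)"
        using D_cover(3) z_mem by blast
      then have "\<rho>0 \<le> \<rho> z0" "C z0 \<le> C0"
        using D_cover(2) by (auto simp: \<rho>0_def C0_def)
      then show ?thesis
        using P_local[of z0 z] z0_mem D_cover(1) z_mem by (blast intro: mono)
    qed
  qed
qed

lemma outward_normal_uniformly_parabolic_boundary:
  assumes "open \<Omega>" "bounded \<Omega>" "C3_boundary \<Omega>"
  obtains \<rho> C where "0 < \<rho>" "0 < C"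
    and "\<And>z n. z \<in> frontier \<Omega> \<Longrightarrow> outward_normal \<Omega> z n \<Longrightarrow> parabolic_boundary_at \<Omega> z n \<rho> C"
proof -
  define P where "P = (\<lambda>\<rho> C z. \<forall>n. outward_normal \<Omega> z n \<longrightarrow> parabolic_boundary_at \<Omega> z n \<rho> C)"
  have mono: "P \<rho>' C' z" if "P \<rho> C z" "\<rho>' \<le> \<rho>" "C \<le> C'" for \<rho> C \<rho>' C' z
    using that unfolding P_def by (blast intro: parabolic_boundary_at_mono)
  have local: "\<exists>\<rho>>0. \<exists>C. \<forall>z\<in>frontier \<Omega> \<inter> ball z0 \<rho>. P \<rho> C z" if "z0 \<in> frontier \<Omega>" for z0
    using outward_normal_locally_parabolic_boundary[OF assms(1,3) that] unfolding P_def
    by (metis IntE)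
  have "compact (frontier \<Omega>)"
    using assms(2) by (rule compact_frontier_bounded)
  then obtain \<rho> C where "0 < \<rho>" "0 < C" "\<And>z. z \<in> frontier \<Omega> \<Longrightarrow> P \<rho> C z"
    by (rule compact_uniform_parameters[of "frontier \<Omega>" P]) (use mono local in blast)+
  then show thesis
    using that unfolding P_def by blast
qed

section \<open>The correction tensor near the boundary\<close>

lemma lmeasurable_ball_Int_open: "open S \<Longrightarrow> ball x r \<inter> S \<in> lmeasurable"
  by (intro lmeasurable_open) auto

locale parabolic_boundary_layer =
  fixes \<Omega> :: "(real^2) set" and x n :: "real^2" and s \<delta> \<rho> C :: real
  assumes open_\<Omega>: "open \<Omega>"
    and boundary: "parabolic_boundary_at \<Omega> (x + s *\<^sub>R n) n \<rho> C"
    and \<delta>_pos: "0 < \<delta>" and \<delta>_le_\<rho>: "2 * \<delta> \<le> \<rho>"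
    and s_nonneg: "0 \<le> s" and s_le_\<delta>: "s \<le> \<delta>"
begin

abbreviation "z \<equiv> x + s *\<^sub>R n"

abbreviation "p \<equiv> tangent_of n"

lemma norm_n: "norm n = 1"
  using boundary by (simp add: parabolic_boundary_at_def)

lemma frame: "orthonormal_frame p n"
  using norm_n by (rule orthonormal_frame_tangent_of)

lemma C_nonneg: "0 \<le> C"
  using boundary by (rule parabolic_boundary_at_nonneg)

lemma lmeasurable_ball_Int_\<Omega>: "ball x \<delta> \<inter> \<Omega> \<in> lmeasurable"
  by (rule lmeasurable_ball_Int_open[OF open_\<Omega>])

lemma lmeasurable_ball_Int_parabolic_region: "ball x \<delta> \<inter> parabolic_region z n \<kappa> \<in> lmeasurable"
  unfolding parabolic_region_def
  by (intro lmeasurable_ball_Int_open open_Collect_less continuous_intros)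

lemma norm_diff_boundary_point_less:
  assumes "y \<in> ball x \<delta>"
  shows "norm (y - z) < 2 * \<delta>"
  using norm_triangle_ineq4[of "y - x" "s *\<^sub>R n"] assms s_nonneg s_le_\<delta> norm_n
  by (simp add: dist_norm norm_minus_commute diff_diff_eq)

lemma mem_ball_boundary_point: "y \<in> ball x \<delta> \<Longrightarrow> y \<in> ball z \<rho>"
  using norm_diff_boundary_point_less[of y] \<delta>_le_\<rho> by (simp add: dist_norm norm_minus_commute)

lemma integral_moment_parabolic_region:
  "integral (ball x \<delta> \<inter> parabolic_region z n \<kappa>) (moment \<delta> x p n) = 0"
proof (rule integral_moment_symmetric_eq_0[OF _ lmeasurable_ball_Int_parabolic_region frame])
  show "0 \<le> \<delta>"
    using \<delta>_pos by simp
  fix y assume y_mem: "y \<in> ball x \<delta> \<inter> parabolic_region z n \<kappa>"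
  have "norm (reflection p (y - x)) = norm (y - x)"
    using frame by (simp add: orthonormal_frame_def norm_reflection)
  then show "x + reflection p (y - x) \<in> ball x \<delta> \<inter> parabolic_region z n \<kappa>"
    using y_mem orthonormal_frame_inner[OF frame] reflection_inner_frame[OF frame, of "y - x"]
    by (simp add: parabolic_region_def dist_norm norm_minus_commute inner_diff_left inner_add_left
        power2_commute[of "x \<bullet> p"])
qed

lemma sym_diff_parabolic_region_subset:
  obtains \<kappa> where "sym_diff (ball x \<delta> \<inter> \<Omega>) (ball x \<delta> \<inter> parabolic_region z n \<kappa>)
    \<subseteq> graph_strip z p n (\<lambda>t. \<kappa> * t\<^sup>2) \<delta> (8 * C * \<delta> ^ 3)"
proof -
  obtain \<kappa> where side: "\<And>y. y \<in> ball z \<rho> \<Longrightarrow> (y \<in> \<Omega> \<longleftrightarrow> y \<in> parabolic_region z n \<kappa>) \<or>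
      \<bar>(y - z) \<bullet> n - \<kappa> * ((y - z) \<bullet> p)\<^sup>2\<bar> \<le> C * norm (y - z) ^ 3"
    using boundary unfolding parabolic_boundary_at_def by blast
  have "y \<in> graph_strip z p n (\<lambda>t. \<kappa> * t\<^sup>2) \<delta> (8 * C * \<delta> ^ 3)"
    if y_mem: "y \<in> ball x \<delta>" and differ: "\<not> (y \<in> \<Omega> \<longleftrightarrow> y \<in> parabolic_region z n \<kappa>)" for y
  proof -
    have "(y - z) \<bullet> p = (y - x) \<bullet> p"
      using orthonormal_frame_inner[OF frame] by (simp add: inner_diff_left inner_add_left)
    then have "\<bar>(y - z) \<bullet> p\<bar> \<le> norm (y - x)"
      using frame by (simp add: orthonormal_frame_def abs_inner_le_norm)
    also have "\<dots> \<le> \<delta>"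
      using y_mem by (simp add: dist_norm norm_minus_commute)
    finally have tangential: "\<bar>(y - z) \<bullet> p\<bar> \<le> \<delta>" .
    have "\<bar>(y - z) \<bullet> n - \<kappa> * ((y - z) \<bullet> p)\<^sup>2\<bar> \<le> C * norm (y - z) ^ 3"
      using side[OF mem_ball_boundary_point[OF y_mem]] differ by simp
    also have "\<dots> \<le> C * (2 * \<delta>) ^ 3"
      using norm_diff_boundary_point_less[OF y_mem] C_nonneg
      by (intro mult_left_mono power_mono) auto
    finally show ?thesis
      using tangential by (simp add: graph_strip_def power_mult_distrib)
  qed
  then show thesis
    using that[of \<kappa>] by blast
qed

lemma abs_integral_mixed_moment_le:
  "\<bar>integral (ball x \<delta> \<inter> \<Omega>) (moment \<delta> x p n)\<bar> \<le> 32 * C * \<delta> ^ 5"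
proof -
  obtain \<kappa> where sym_diff: "sym_diff (ball x \<delta> \<inter> \<Omega>) (ball x \<delta> \<inter> parabolic_region z n \<kappa>)
      \<subseteq> graph_strip z p n (\<lambda>t. \<kappa> * t\<^sup>2) \<delta> (8 * C * \<delta> ^ 3)"
    by (rule sym_diff_parabolic_region_subset)
  define W where "W = graph_strip z p n (\<lambda>t. \<kappa> * t\<^sup>2) \<delta> (8 * C * \<delta> ^ 3)"
  have "((\<lambda>t. \<kappa> * t\<^sup>2) has_real_derivative 2 * \<kappa> * t) (at t)" for t
    by (auto intro!: derivative_eq_intros)
  note strip_measure = graph_strip_measure[OF frame this]
  have W_meas: "W \<in> lmeasurable" and W_measure: "measure lebesgue W \<le> 4 * \<delta> * (8 * C * \<delta> ^ 3)"
    unfolding W_def using \<delta>_pos C_nonneg by (intro strip_measure; simp)+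
  have "\<bar>integral (ball x \<delta> \<inter> \<Omega>) (moment \<delta> x p n)
      - integral (ball x \<delta> \<inter> parabolic_region z n \<kappa>) (moment \<delta> x p n)\<bar> \<le> \<delta> * measure lebesgue W"
  proof (rule abs_integral_diff_le)
    show "\<bar>moment \<delta> x p n y\<bar> \<le> \<delta>" for y
      using abs_moment_le[of \<delta> x p n y] \<delta>_pos frame by (simp add: orthonormal_frame_def)
  qed (use \<delta>_pos W_meas sym_diff lmeasurable_ball_Int_\<Omega> lmeasurable_ball_Int_parabolic_region
      in \<open>simp_all add: W_def moment_integrable\<close>)
  also have "\<dots> \<le> \<delta> * (4 * \<delta> * (8 * C * \<delta> ^ 3))"
    using W_measure \<delta>_pos by (intro mult_left_mono) auto
  also have "\<dots> = 32 * C * \<delta> ^ 5"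
    by (simp add: eval_nat_numeral)
  finally show ?thesis
    by (simp add: integral_moment_parabolic_region)
qed

lemma abs_acoef_mixed_le: "\<bar>acoef \<Omega> \<delta> x p n\<bar> \<le> 32 * C * \<delta>\<^sup>2"
proof -
  have "\<bar>acoef \<Omega> \<delta> x p n\<bar> = 3 / (pi * \<delta> ^ 3) * \<bar>integral (ball x \<delta> \<inter> \<Omega>) (moment \<delta> x p n)\<bar>"
    using \<delta>_pos by (simp add: acoef_eq_integral_moment mvol_def abs_mult)
  also have "\<dots> \<le> 3 / (pi * \<delta> ^ 3) * (32 * C * \<delta> ^ 5)"
    using abs_integral_mixed_moment_le \<delta>_pos by (intro mult_left_mono) auto
  also have "\<dots> = 3 / pi * (32 * C * \<delta>\<^sup>2)"
    using \<delta>_pos by (simp add: eval_nat_numeral)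
  also have "\<dots> \<le> 1 * (32 * C * \<delta>\<^sup>2)"
    using pi_gt3 C_nonneg by (intro mult_right_mono) auto
  finally show ?thesis
    by simp
qed

lemma mem_if_below_boundary:
  assumes \<delta>_small: "\<delta> \<le> 1" "48 * C * \<delta> \<le> 1"
    and y_mem: "y \<in> ball x \<delta>" and below: "(y - x) \<bullet> n < - (\<delta>/4)"
  shows "y \<in> \<Omega>"
proof -
  have normal: "(y - z) \<bullet> n < - (\<delta>/4)"
    using below s_nonneg orthonormal_frame_inner[OF frame]
    by (simp add: inner_diff_left inner_add_left)
  have "norm (y - z) ^ 2 + norm (y - z) ^ 3 \<le> (2 * \<delta>) ^ 2 + (2 * \<delta>) ^ 3"
    using norm_diff_boundary_point_less[OF y_mem] by (intro add_mono power_mono) auto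
  also have "\<dots> \<le> 12 * \<delta>\<^sup>2"
    using \<delta>_pos \<delta>_small(1) power_decreasing[of 2 3 \<delta>] by (simp add: power_mult_distrib)
  finally have "C * (norm (y - z) ^ 2 + norm (y - z) ^ 3) \<le> C * (12 * \<delta>\<^sup>2)"
    using C_nonneg by (rule mult_left_mono)
  also have "\<dots> = (48 * C * \<delta>) * (\<delta>/4)"
    by (simp add: power2_eq_square)
  also have "\<dots> \<le> 1 * (\<delta>/4)"
    using \<delta>_pos \<delta>_small(2) by (intro mult_right_mono) auto
  finally have "C * (norm (y - z))\<^sup>2 + C * norm (y - z) ^ 3 < \<bar>(y - z) \<bullet> n\<bar>"
    using normal by (simp add: distrib_left)
  then have "y \<in> \<Omega> \<longleftrightarrow> (y - z) \<bullet> n < 0"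
    by (rule parabolic_boundary_at_mem_iff[OF boundary mem_ball_boundary_point[OF y_mem]])
  then show ?thesis
    using normal \<delta>_pos by simp
qed

lemma mem_quadrant_ball:
  assumes "y \<in> ball (x + (3/8 * \<delta>) *\<^sub>R (p - n)) (\<delta>/8)"
  shows "\<delta>/4 < (y - x) \<bullet> p" "(y - x) \<bullet> n < - (\<delta>/4)" "y \<in> ball x \<delta>"
proof -
  define c where "c = (3/8 * \<delta>) *\<^sub>R (p - n)"
  have norms: "norm p = 1" "norm n = 1"
    using frame by (simp_all add: orthonormal_frame_def)
  have near: "norm (y - x - c) < \<delta>/8"
    using assms by (simp add: c_def dist_norm norm_minus_commute algebra_simps)
  then have "\<bar>(y - x - c) \<bullet> p\<bar> < \<delta>/8" "\<bar>(y - x - c) \<bullet> n\<bar> < \<delta>/8"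
    using norms abs_inner_le_norm[of p "y - x - c"] abs_inner_le_norm[of n "y - x - c"] by auto
  moreover have "(y - x - c) \<bullet> p = (y - x) \<bullet> p - 3/8 * \<delta>"
    and "(y - x - c) \<bullet> n = (y - x) \<bullet> n + 3/8 * \<delta>"
    using orthonormal_frame_inner[OF frame] by (simp_all add: c_def inner_diff_left)
  ultimately show "\<delta>/4 < (y - x) \<bullet> p" "(y - x) \<bullet> n < - (\<delta>/4)"
    by linarith+
  have "norm c \<le> 3/8 * \<delta> * (1 + 1)"
    using norm_triangle_ineq4[of p n] \<delta>_pos norms by (simp add: c_def)
  then show "y \<in> ball x \<delta>"
    using near norm_triangle_sub[of "y - x" c] \<delta>_pos by (simp add: dist_norm norm_minus_commute)
qed

lemma integral_diagonal_moment_ge: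
  assumes \<delta>_small: "\<delta> \<le> 1" "48 * C * \<delta> \<le> 1" and "v \<in> {p, n}"
  shows "pi * \<delta> ^ 3 / 1024 \<le> integral (ball x \<delta> \<inter> \<Omega>) (moment \<delta> x v v)"
proof -
  \<comment> \<open>in the quadrant facing away from the boundary, hence inside the domain and off both axes\<close>
  define B where "B = ball (x + (3/8 * \<delta>) *\<^sub>R (p - n)) (\<delta>/8)"
  note quadrant = mem_quadrant_ball[folded B_def]
  have "B \<subseteq> ball x \<delta> \<inter> \<Omega> \<inter> cball x \<delta>"
    using quadrant mem_if_below_boundary[OF \<delta>_small] by force
  moreover have "\<delta>/4 \<le> \<bar>(y - x) \<bullet> v\<bar>" if "y \<in> B" for y
    using quadrant[OF that] assms(3) by auto
  ultimately have "(\<delta>/4)\<^sup>2 / \<delta> * measure lebesgue B \<le> integral (ball x \<delta> \<inter> \<Omega>) (moment \<delta> x v v)"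
    using \<delta>_pos by (intro integral_moment_ge lmeasurable_ball_Int_\<Omega>) (auto simp: B_def)
  moreover have "measure lebesgue B = pi * (\<delta>/8)\<^sup>2"
    using \<delta>_pos by (simp add: B_def content_ball unit_ball_vol_2)
  ultimately show ?thesis
    using \<delta>_pos by (simp add: power2_eq_square power3_eq_cube mult_ac)
qed

lemma acoef_diagonal_ge:
  assumes "\<delta> \<le> 1" "48 * C * \<delta> \<le> 1" "v \<in> {p, n}"
  shows "3 / 1024 \<le> acoef \<Omega> \<delta> x v v"
proof -
  have "3 / 1024 = 3 / (pi * \<delta> ^ 3) * (pi * \<delta> ^ 3 / 1024)"
    using \<delta>_pos by simp
  also have "\<dots> \<le> 3 / (pi * \<delta> ^ 3) * integral (ball x \<delta> \<inter> \<Omega>) (moment \<delta> x v v)"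
    using integral_diagonal_moment_ge[OF assms] \<delta>_pos by (intro mult_left_mono) auto
  also have "\<dots> = acoef \<Omega> \<delta> x v v"
    by (simp add: acoef_eq_integral_moment mvol_def)
  finally show ?thesis .
qed

lemma matrix_inv_Amat_bounds:
  assumes \<delta>_small: "\<delta> \<le> 1" "64 * C * \<delta> \<le> 3 / 1024"
  defines "A \<equiv> Amat \<Omega> \<delta> x" and "c \<equiv> 3 / 1024" and "\<epsilon> \<equiv> 32 * C * \<delta>\<^sup>2"
  defines "M \<equiv> matrix_inv A"
  shows "invertible A" "transpose M = M"
    "\<bar>p \<bullet> (M *v p) - 1 / acoef \<Omega> \<delta> x p p\<bar> \<le> 2 / c ^ 3 * \<epsilon>\<^sup>2"
    "\<bar>p \<bullet> (M *v n)\<bar> \<le> 2 / c\<^sup>2 * \<epsilon>"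
    "\<bar>n \<bullet> (M *v p)\<bar> \<le> 2 / c\<^sup>2 * \<epsilon>"
    "\<bar>n \<bullet> (M *v n) - 1 / acoef \<Omega> \<delta> x n n\<bar> \<le> 2 / c ^ 3 * \<epsilon>\<^sup>2"
proof -
  have acoef_eq: "acoef \<Omega> \<delta> x u v = u \<bullet> (A *v v)" for u v
    using open_\<Omega> \<delta>_pos unfolding A_def by (intro acoef_eq_inner_Amat) auto
  have symmetric: "transpose A = A"
    unfolding A_def by (rule transpose_Amat)
  have mixed: "\<bar>p \<bullet> (A *v n)\<bar> \<le> \<epsilon>" "\<bar>n \<bullet> (A *v p)\<bar> \<le> \<epsilon>"
    using abs_acoef_mixed_le inner_matrix_vector_commute[OF symmetric, of n p]
    by (simp_all add: acoef_eq \<epsilon>_def)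
  have "48 * C * \<delta> \<le> 1"
    using \<delta>_small(2) mult_nonneg_nonneg[of C \<delta>] C_nonneg \<delta>_pos by linarith
  then have diagonal: "0 < c" "c \<le> p \<bullet> (A *v p)" "c \<le> n \<bullet> (A *v n)"
    using acoef_diagonal_ge[OF \<delta>_small(1)] by (simp_all add: acoef_eq c_def)
  have "\<epsilon> \<le> 32 * C * \<delta>"
    unfolding \<epsilon>_def using C_nonneg \<delta>_pos \<delta>_small(1)
    by (intro mult_left_mono) (auto simp: power2_eq_square)
  then have "\<epsilon>\<^sup>2 \<le> (c/2)\<^sup>2"
    using C_nonneg \<delta>_small(2) by (intro power_mono) (simp_all add: c_def \<epsilon>_def)
  then have small: "2 * \<epsilon>\<^sup>2 \<le> c\<^sup>2"
    by (simp add: power_divide) (use zero_le_power2[of \<epsilon>] in linarith)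
  note bounds = matrix_inv_nearly_diagonal[OF frame symmetric diagonal mixed(1) small]
    matrix_inv_nearly_diagonal[OF orthonormal_frame_swap[OF frame] symmetric
      diagonal(1,3,2) mixed(2) small]
  show "invertible A"
    by (rule bounds(1))
  then show "transpose M = M"
    unfolding M_def by (rule transpose_matrix_inv[OF symmetric])
  show "\<bar>p \<bullet> (M *v p) - 1 / acoef \<Omega> \<delta> x p p\<bar> \<le> 2 / c ^ 3 * \<epsilon>\<^sup>2"
    "\<bar>p \<bullet> (M *v n)\<bar> \<le> 2 / c\<^sup>2 * \<epsilon>"
    "\<bar>n \<bullet> (M *v p)\<bar> \<le> 2 / c\<^sup>2 * \<epsilon>"
    "\<bar>n \<bullet> (M *v n) - 1 / acoef \<Omega> \<delta> x n n\<bar> \<le> 2 / c ^ 3 * \<epsilon>\<^sup>2"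
    using bounds unfolding acoef_eq M_def by blast+
qed

end

definition correction_tensor_expansion ::
    "(real^2) set \<Rightarrow> real \<Rightarrow> real^2 \<Rightarrow> real^2 \<Rightarrow> real \<Rightarrow> bool" where
  "correction_tensor_expansion \<Omega> \<delta> x n C \<longleftrightarrow>
    (let A = Amat \<Omega> \<delta> x; M = matrix_inv A; p = tangent_of n;
         app = acoef \<Omega> \<delta> x p p; ann = acoef \<Omega> \<delta> x n n; apn = acoef \<Omega> \<delta> x p n
     in invertible A \<and> transpose M = M \<and>
        \<bar>apn\<bar> \<le> C * \<delta>\<^sup>2 \<and>
        \<bar>p \<bullet> (M *v p) - 1 / app\<bar> \<le> C * \<delta> ^ 4 \<and>
        \<bar>p \<bullet> (M *v n)\<bar> \<le> C * \<delta>\<^sup>2 \<and>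
        \<bar>n \<bullet> (M *v p)\<bar> \<le> C * \<delta>\<^sup>2 \<and>
        \<bar>n \<bullet> (M *v n) - 1 / ann\<bar> \<le> C * \<delta> ^ 4)"

lemma (in parabolic_boundary_layer) correction_tensor_expansion:
  assumes "\<delta> \<le> 1" "64 * C * \<delta> \<le> 3 / 1024"
  shows "correction_tensor_expansion \<Omega> \<delta> x n (2 / (3 / 1024) ^ 3 * (1 + 32 * C)\<^sup>2)"
proof -
  define c :: real where "c = 3 / 1024"
  define \<epsilon> where "\<epsilon> = 32 * C * \<delta>\<^sup>2"
  define K where "K = 2 / c ^ 3 * (1 + 32 * C)\<^sup>2"
  have C_le_square: "32 * C \<le> (1 + 32 * C)\<^sup>2" "(32 * C)\<^sup>2 \<le> (1 + 32 * C)\<^sup>2"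
    using C_nonneg by (simp_all add: power2_eq_square algebra_simps)
  have "1 * (32 * C) \<le> K" "2 / c\<^sup>2 * (32 * C) \<le> K"
    unfolding K_def using C_le_square(1) C_nonneg
    by (intro mult_mono; simp add: c_def power2_eq_square power3_eq_cube)+
  then have "1 * (32 * C) * \<delta>\<^sup>2 \<le> K * \<delta>\<^sup>2" "2 / c\<^sup>2 * (32 * C) * \<delta>\<^sup>2 \<le> K * \<delta>\<^sup>2"
    by (simp_all only: mult_right_mono zero_le_power2)
  then have quadratic: "\<epsilon> \<le> K * \<delta>\<^sup>2" "2 / c\<^sup>2 * \<epsilon> \<le> K * \<delta>\<^sup>2"
    by (simp_all add: \<epsilon>_def mult.assoc)
  have "2 / c ^ 3 * (32 * C)\<^sup>2 \<le> K"
    unfolding K_def using C_le_square(2) by (intro mult_left_mono) (simp_all add: c_def)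
  then have "2 / c ^ 3 * (32 * C)\<^sup>2 * \<delta> ^ 4 \<le> K * \<delta> ^ 4"
    by (rule mult_right_mono) simp
  then have quartic: "2 / c ^ 3 * \<epsilon>\<^sup>2 \<le> K * \<delta> ^ 4"
    by (simp add: \<epsilon>_def power_mult_distrib)
  have "correction_tensor_expansion \<Omega> \<delta> x n K"
    using matrix_inv_Amat_bounds[OF assms, folded c_def \<epsilon>_def]
      abs_acoef_mixed_le[folded \<epsilon>_def] quadratic quartic
    unfolding correction_tensor_expansion_def Let_def by linarith
  then show ?thesis
    by (simp only: K_def c_def)
qed

theorem theorem1:
  fixes \<Omega> \<Gamma>D \<Gamma>N :: "(real^2) set" and nvec :: "real^2 \<Rightarrow> real^2"
  assumes dom: "bounded_domain \<Omega>"
    and bdry: "C3_boundary \<Omega>"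
    and split: "\<Gamma>D \<union> \<Gamma>N = frontier \<Omega>"
    and normal: "\<forall>z\<in>\<Gamma>N. outward_normal \<Omega> z (nvec z)"
  shows "\<exists>\<delta>bar > 0. \<exists>C > 0. \<forall>\<delta> x xb s.
    0 < \<delta> \<and> \<delta> \<le> \<delta>bar \<and> x \<in> I_Omega_N \<Omega> \<Gamma>N \<delta> \<and> xb \<in> \<Gamma>N \<and>
    0 < s \<and> s < \<delta> \<and> xb - x = s *\<^sub>R nvec xb \<longrightarrow>
      (let A = Amat \<Omega> \<delta> x; M = matrix_inv A; n = nvec xb; p = tangent_of n;
           app = acoef \<Omega> \<delta> x p p; ann = acoef \<Omega> \<delta> x n n; apn = acoef \<Omega> \<delta> x p n
       in invertible A \<and> transpose M = M \<and>
          \<bar>apn\<bar> \<le> C * \<delta>\<^sup>2 \<and>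
          \<bar>p \<bullet> (M *v p) - 1 / app\<bar> \<le> C * \<delta> ^ 4 \<and>
          \<bar>p \<bullet> (M *v n)\<bar> \<le> C * \<delta>\<^sup>2 \<and>
          \<bar>n \<bullet> (M *v p)\<bar> \<le> C * \<delta>\<^sup>2 \<and>
          \<bar>n \<bullet> (M *v n) - 1 / ann\<bar> \<le> C * \<delta> ^ 4)"
proof -
  have domain: "open \<Omega>" "bounded \<Omega>"
    using dom by (simp_all add: bounded_domain_def)
  obtain \<rho> C where pos: "0 < \<rho>" "0 < C"
    and boundary: "\<And>z n. z \<in> frontier \<Omega> \<Longrightarrow> outward_normal \<Omega> z n \<Longrightarrow> parabolic_boundary_at \<Omega> z n \<rho> C"
    using outward_normal_uniformly_parabolic_boundary[OF domain bdry] by blast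
  define \<delta>bar where "\<delta>bar = Min {\<rho> / 2, 1, 3 / (1024 * (64 * C))}"
  define K where "K = 2 / (3 / 1024) ^ 3 * (1 + 32 * C)\<^sup>2"
  have "correction_tensor_expansion \<Omega> \<delta> x (nvec xb) K"
    if "0 < \<delta>" "\<delta> \<le> \<delta>bar" and xb: "xb \<in> \<Gamma>N" "xb - x = s *\<^sub>R nvec xb"
      and "0 < s" "s < \<delta>" for \<delta> x xb s
  proof -
    have "parabolic_boundary_at \<Omega> (x + s *\<^sub>R nvec xb) (nvec xb) \<rho> C"
      unfolding xb(2)[symmetric] using boundary split normal xb(1) by auto
    then have "parabolic_boundary_layer \<Omega> x (nvec xb) s \<delta> \<rho> C"
      using that domain(1) by unfold_locales (simp_all add: \<delta>bar_def)
    then show ?thesis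
      unfolding K_def using that pos
      by (intro parabolic_boundary_layer.correction_tensor_expansion)
        (auto simp: \<delta>bar_def field_simps)
  qed
  moreover have "0 < \<delta>bar" "0 < K"
    using pos by (simp_all add: \<delta>bar_def K_def)
  ultimately show ?thesis
    unfolding correction_tensor_expansion_def Let_def by blast
qed

end
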